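(* Let $\{(U_{k,i}, V_{k,i}); i \geq 1, k \geq 1\}$ be an array of i.i.d. two-dimensional random vectors and let $\{p_n; n \geq 1\}$ be a sequence of positive integers (not necessarily monotone) such that $n/p_n$ is bounded away from $0$ and $\infty$. Let $$T_n = \max_{1 \leq i \neq j \leq p_n} \Big| \sum_{k=1}^n U_{k,i} V_{k,j} \Big|, \quad n \geq 1.$$ Let $\alpha > 1/2$. Then $$\lim_{n \to \infty} \frac{T_n}{n^\alpha} = 0 \quad \text{a.s.}$$ if and only if $$\sum_{n=1}^{\infty} P\Big(\max_{1 \leq i \neq j \leq n} |U_{1,i} V_{1,j}| \geq n^\alpha\Big) < \infty$$ and, in the case $\alpha \leq 1$, additionally $(EU_{1,1})(EV_{1,1}) = 0$. *)

theory Defs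
  imports "HOL-Probability.Probability"
begin

text \<open>Off-diagonal maximum: max over 1 <= i, j <= m, i ~= j of |f i j|,
  with the convention that the maximum over the empty index set (m <= 1) is 0.\<close>
definition offdiag_max :: "nat \<Rightarrow> (nat \<Rightarrow> nat \<Rightarrow> real) \<Rightarrow> real" where
  "offdiag_max m f = Max (insert 0 {\<bar>f i j\<bar> | i j. i \<in> {1..m} \<and> j \<in> {1..m} \<and> i \<noteq> j})"

end

theory Submission
  imports Defs "HOL-Real_Asymp.Real_Asymp"
begin

text \<open>
  For \<open>\<Leftarrow>\<close>, grouping the hypothesis into dyadic blocks shows that almost surely, for all large
  \<open>n\<close>, every product \<open>U k i * V k j\<close> with \<open>k \<le> n\<close> and \<open>i \<noteq> j\<close> of order \<open>n\<close> is smaller than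
  \<open>\<eta> n\<^sup>\<alpha>\<close>, so that all sums agree with sums of products truncated at this level. Unless \<open>U\<close> or
  \<open>V\<close> vanishes almost surely, the hypothesis gives both of them a moment of order \<open>2 / \<alpha>\<close>, hence the
  product a moment of some order \<open>r > 1 / \<alpha>\<close>, where \<open>r = 2\<close> and the product is centred if
  \<open>\<alpha> \<le> 1\<close>, and \<open>r \<le> 1\<close> if \<open>\<alpha> > 1\<close>. An exponential moment of the truncated product then bounds the
  tail of one sum by a multiple of \<open>n\<close> to the power \<open>-4\<close> when \<open>\<eta>\<close> is small enough, and a union
  bound over the order \<open>n\<^sup>2\<close> pairs is summable.

  For \<open>\<Rightarrow>\<close>, row \<open>n\<close> is the difference of the sums at times \<open>n\<close> and \<open>n - 1\<close>, so its products over
  \<open>i \<noteq> j \<le> n div K\<close> are almost surely eventually smaller than \<open>n\<^sup>\<alpha>\<close>. The rows are independent, so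
  the second Borel-Cantelli lemma applies, and exchangeability within a row replaces \<open>n div K\<close> by
  \<open>n\<close> at the cost of a constant factor. For \<open>\<alpha> \<le> 1\<close> the products are now square integrable, and
  their averages converge both to their mean and to \<open>0\<close>.
\<close>

section \<open>Real-valued preliminaries\<close>

text \<open>As the image of a finite set the index set is visibly finite, which the facts about
  \<open>Max\<close> require.\<close>

lemma offdiag_max_image:
  "offdiag_max m f = Max (insert 0 ((\<lambda>(i, j). \<bar>f i j\<bar>) ` ({1..m} \<times> {1..m} - Id)))"
  unfolding offdiag_max_def by (rule arg_cong[where f="\<lambda>A. Max (insert 0 A)"]) (auto, metis)

text \<open>Positivity of \<open>t\<close> takes care of the inserted 0.\<close>

lemma offdiag_max_less_iff:
  assumes "0 < t"
  shows "offdiag_max m f < t \<longleftrightarrow> (\<forall>i\<in>{1..m}. \<forall>j\<in>{1..m}. i \<noteq> j \<longrightarrow> \<bar>f i j\<bar> < t)"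
proof -
  have "offdiag_max m f < t \<longleftrightarrow> (\<forall>(i, j)\<in>{1..m} \<times> {1..m} - Id. \<bar>f i j\<bar> < t)"
    unfolding offdiag_max_image using assms by (subst Max_less_iff) (simp_all add: case_prod_beta)
  also have "\<dots> \<longleftrightarrow> (\<forall>i j. (i, j) \<in> {1..m} \<times> {1..m} - Id \<longrightarrow> \<bar>f i j\<bar> < t)"
    by (simp only: Ball_def split_paired_All prod.case)
  also have "\<dots> \<longleftrightarrow> (\<forall>i\<in>{1..m}. \<forall>j\<in>{1..m}. i \<noteq> j \<longrightarrow> \<bar>f i j\<bar> < t)"
    by blast
  finally show ?thesis .
qed

lemma offdiag_max_nonneg: "0 \<le> offdiag_max m f"
  unfolding offdiag_max_image by (intro Max_ge) auto

lemma offdiag_max_ge: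
  "i \<in> {1..m} \<Longrightarrow> j \<in> {1..m} \<Longrightarrow> i \<noteq> j \<Longrightarrow> \<bar>f i j\<bar> \<le> offdiag_max m f"
  unfolding offdiag_max_image by (intro Max_ge) force+

text \<open>The blocks are disjoint and fill \<open>{1<..2 ^ L}\<close>, so partial sums of block
  sums are partial sums of \<open>f\<close>, bounded by \<open>suminf f\<close>.\<close>

lemma summable_dyadic_blocks:
  fixes f :: "nat \<Rightarrow> real"
  assumes "summable f" and nonneg: "\<And>n. 0 \<le> f n"
  shows "summable (\<lambda>l. \<Sum>n\<in>{2 ^ l<..2 ^ Suc l}. f n)"
proof (rule bounded_imp_summable)
  show "0 \<le> (\<Sum>n\<in>{2 ^ l<..2 ^ Suc l}. f n)" for l
    by (intro sum_nonneg nonneg)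
  have partial: "(\<Sum>l<L. \<Sum>n\<in>{2 ^ l<..2 ^ Suc l}. f n) = (\<Sum>n\<in>{1<..2 ^ L}. f n)" for L
  proof (induction L)
    case (Suc L)
    have "{1<..2 ^ Suc L} = {1<..2 ^ L} \<union> {2 ^ L<..2 ^ Suc L :: nat}"
      using one_le_power[of "2 :: nat" L] by auto
    then have "(\<Sum>n\<in>{1<..2 ^ Suc L}. f n)
        = (\<Sum>n\<in>{1<..2 ^ L}. f n) + (\<Sum>n\<in>{2 ^ L<..2 ^ Suc L}. f n)"
      by (simp only:) (intro sum.union_disjoint; auto)
    then show ?case using Suc by simp
  qed simp
  show "(\<Sum>l\<le>L. \<Sum>n\<in>{2 ^ l<..2 ^ Suc l}. f n) \<le> suminf f" for L
    unfolding lessThan_Suc_atMost[symmetric] partial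
    by (intro sum_le_suminf assms) auto
qed

text \<open>The exponent of the bound \<open>truncated_sum_tail\<close> at truncation level \<open>b = \<eta> n\<^sup>\<alpha>\<close>. With
  \<open>L = 4 / \<epsilon>\<close> the value of \<open>t\<close> makes \<open>t * (\<epsilon> n\<^sup>\<alpha>) = 4 ln n\<close>; the constraint on \<open>\<eta>\<close> keeps the growth
  \<open>exp (t * b)\<close> below the polynomial decay of the other factors.\<close>
lemma truncation_exponent_eventually:
  fixes \<alpha> r \<mu> L \<eta> :: real
  assumes r: "1 < \<alpha> * r" and L: "0 < L" and \<eta>: "0 < \<eta>" "L * \<eta> = (\<alpha> * r - 1) / 2"
  shows "eventually (\<lambda>n. let t = L * ln (real n) / real n powr \<alpha>; b = \<eta> * real n powr \<alpha> in
    real n * (t * b powr (1 - r) * \<mu> + t\<^sup>2 * b powr (2 - r) * \<mu> * exp (t * b)) \<le> 1) sequentially"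
proof -
  define \<delta> where "\<delta> = \<alpha> * r - 1"
  have \<delta>: "0 < \<delta>" using r by (simp add: \<delta>_def)
  define C where "C = L * \<eta> powr (1 - r) * \<mu>"
  define D where "D = L\<^sup>2 * \<eta> powr (2 - r) * \<mu>"
  have "((\<lambda>n. C * (ln (real n) * real n powr (- \<delta>))
      + D * ((ln (real n))\<^sup>2 * real n powr (- (\<delta> / 2)))) \<longlongrightarrow> C * 0 + D * 0) sequentially"
  proof (intro tendsto_add tendsto_mult_left)
    show "(\<lambda>n. ln (real n) * real n powr (- \<delta>)) \<longlonglongrightarrow> 0"
      using \<delta> by real_asymp
    show "(\<lambda>n. (ln (real n))\<^sup>2 * real n powr (- (\<delta> / 2))) \<longlonglongrightarrow> 0"
      using \<delta> by real_asymp
  qed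
  then have "eventually (\<lambda>n. C * (ln (real n) * real n powr (- \<delta>))
      + D * ((ln (real n))\<^sup>2 * real n powr (- (\<delta> / 2))) < 1) sequentially"
    by (intro order_tendstoD) auto
  with eventually_gt_at_top[of 0] show ?thesis
  proof eventually_elim
    case (elim n)
    define x where "x = real n"
    have x: "0 < x" using elim by (simp add: x_def)
    define t b where "t = L * ln x / x powr \<alpha>" and "b = \<eta> * x powr \<alpha>"
    have b: "b powr s = \<eta> powr s * x powr (\<alpha> * s)" for s
      using \<eta> x by (simp add: b_def powr_mult powr_powr)
    have t: "t = L * ln x * x powr (- \<alpha>)"
      by (simp add: t_def powr_minus divide_inverse)
    have tb: "t * b = L * \<eta> * ln x"
      using x by (simp add: t_def b_def)
    \<comment> \<open>Here the constraint on \<open>\<eta>\<close> enters: t b = (\<delta> / 2) ln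
      x, so the exponential spends only half of the decay of order -\<delta> that the second term
      has without it.\<close>
    have e: "exp (t * b) = x powr (\<delta> / 2)"
      unfolding tb \<eta> \<delta>_def using x by (simp add: powr_def)
    have 1: "x * (t * b powr (1 - r) * \<mu>) = C * (ln x * x powr (- \<delta>))"
    proof -
      have "x * x powr (- \<alpha>) * x powr (\<alpha> * (1 - r)) = x powr (- \<delta>)"
        using x by (simp add: \<delta>_def powr_add[symmetric] powr_mult_base algebra_simps)
      then show ?thesis unfolding t b C_def by (simp add: mult_ac)
    qed
    have 2: "x * (t\<^sup>2 * b powr (2 - r) * \<mu> * exp (t * b)) = D * ((ln x)\<^sup>2 * x powr (- (\<delta> / 2)))"
    proof -
      have "x * (x powr (- \<alpha>))\<^sup>2 * x powr (\<alpha> * (2 - r)) * x powr (\<delta> / 2) = x powr (- (\<delta> / 2))"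
      proof -
        have "x * (x powr (- \<alpha>))\<^sup>2 * x powr (\<alpha> * (2 - r)) * x powr (\<delta> / 2)
            = x powr (1 + (- \<alpha> + - \<alpha>) + \<alpha> * (2 - r) + \<delta> / 2)"
          using x by (simp only: powr_add power2_eq_square powr_one)
        also have "1 + (- \<alpha> + - \<alpha>) + \<alpha> * (2 - r) + \<delta> / 2 = - (\<delta> / 2)"
          by (simp add: \<delta>_def field_simps)
        finally show ?thesis .
      qed
      then show ?thesis unfolding e unfolding t b D_def by (simp add: mult_ac power_mult_distrib)
    qed
    show ?case
      using elim 1 2 unfolding Let_def x_def[symmetric] t_def[symmetric] b_def[symmetric]
      by (simp add: distrib_left)
  qed
qed

text \<open>Multiplying 1 - x \<le> exp (-x) by exp x bounds the remainder exp x - 1 - x by x (exp x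
  - 1), and the last factor is at most |x| exp |x| in absolute value.\<close>

lemma exp_le_quadratic: "exp x \<le> 1 + x + x\<^sup>2 * exp \<bar>x\<bar>" for x :: real
proof -
  have "1 - x \<le> exp (- x)"
    using exp_ge_add_one_self[of "- x"] by simp
  then have "(1 - x) * exp x \<le> 1"
    by (metis exp_minus_inverse mult.commute mult_right_mono exp_ge_zero)
  then have "exp x - 1 - x \<le> x * (exp x - 1)"
    by (simp add: algebra_simps)
  also have "\<dots> \<le> \<bar>x\<bar> * \<bar>exp x - 1\<bar>"
    by (metis abs_ge_self abs_mult)
  also have "\<dots> \<le> \<bar>x\<bar> * (\<bar>x\<bar> * exp \<bar>x\<bar>)"
  proof (rule mult_left_mono)
    show "\<bar>exp x - 1\<bar> \<le> \<bar>x\<bar> * exp \<bar>x\<bar>"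
    proof (cases "0 \<le> x")
      case True
      then show ?thesis using \<open>(1 - x) * exp x \<le> 1\<close> by (simp add: algebra_simps)
    next
      case False
      have "1 - exp x \<le> \<bar>x\<bar> * 1"
        using exp_ge_add_one_self[of x] False by linarith
      also have "\<dots> \<le> \<bar>x\<bar> * exp \<bar>x\<bar>"
        by (intro mult_left_mono) auto
      finally show ?thesis using False by simp
    qed
  qed simp
  finally show ?thesis by (simp add: power2_eq_square)
qed

section \<open>Independent random variables\<close>

context prob_space
begin

text \<open>Taking expectations in \<open>exp_le_quadratic\<close> leaves the first two moments of
  the truncated variable \<open>T\<close>, and 1 + y \<le> exp y restores an exponential. Both
  moments are controlled by the moment of order \<open>r\<close>. The mean is estimated directly if
  r \<le> 1 and through centring if r \<ge> 1.\<close>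

lemma truncated_exp_moment:
  fixes Z :: "'a \<Rightarrow> real"
  assumes [measurable]: "random_variable borel Z"
    and r: "r \<le> 2" "integrable M (\<lambda>x. \<bar>Z x\<bar> powr r)" "expectation (\<lambda>x. \<bar>Z x\<bar> powr r) = \<mu>"
    and centred: "r \<le> 1 \<or> 1 \<le> r \<and> integrable M Z \<and> expectation Z = 0"
    and b: "b > 0" and t: "t \<ge> 0"
  shows "expectation (\<lambda>x. exp (t * (if \<bar>Z x\<bar> \<le> b then Z x else 0)))
    \<le> exp (t * b powr (1 - r) * \<mu> + t\<^sup>2 * b powr (2 - r) * \<mu> * exp (t * b))"
proof -
  define T where "T x = (if \<bar>Z x\<bar> \<le> b then Z x else 0)" for x
  have [measurable]: "random_variable borel T"
    unfolding T_def by simp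
  have T_bound: "\<bar>T x\<bar> \<le> b" for x
    using b by (simp add: T_def)
  have T_int: "integrable M T"
    by (rule integrable_const_bound[where B=b]) (auto simp: T_bound)
  have T2_int: "integrable M (\<lambda>x. (T x)\<^sup>2)"
    by (rule integrable_const_bound[where B="b\<^sup>2"]) (use T_bound b in \<open>auto intro!: AE_I2 simp: abs_le_square_iff[symmetric]\<close>)
  have exp_int: "integrable M (\<lambda>x. exp (t * T x))"
    by (rule integrable_const_bound[where B="exp (t * b)"])
       (use T_bound t in \<open>auto intro!: AE_I2 mult_left_mono dest: abs_le_D1\<close>)
  \<comment> \<open>Below the truncation level a power of higher order \<open>a\<close> is paid for
    by the moment of order \<open>r\<close> and a power of \<open>b\<close>.\<close>
  have powr_split: "y powr a \<le> b powr (a - r) * y powr r" if "0 \<le> y" "y \<le> b" "r \<le> a" for y a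
  proof (cases "y = 0")
    case False
    then have "y powr a = y powr (a - r) * y powr r"
      by (simp add: powr_add[symmetric])
    also have "\<dots> \<le> b powr (a - r) * y powr r"
      using that by (intro mult_right_mono powr_mono2) auto
    finally show ?thesis .
  qed simp
  have mean: "expectation T \<le> b powr (1 - r) * \<mu>"
    using centred
  proof
    assume "r \<le> 1"
    have "T x \<le> b powr (1 - r) * \<bar>Z x\<bar> powr r" for x
      using powr_split[of "\<bar>Z x\<bar>" 1] \<open>r \<le> 1\<close> by (auto simp: T_def)
    then have "expectation T \<le> expectation (\<lambda>x. b powr (1 - r) * \<bar>Z x\<bar> powr r)"
      using r by (intro integral_mono T_int) auto
    then show ?thesis using r by simp
  next
    \<comment> \<open>By centring, the mean of \<open>T\<close> is the mean of \<open>T - Z\<close>.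
      This difference lives on |Z| > b, where the surplus power r - 1 of |Z| is at least b to that
      power.\<close>
    assume *: "1 \<le> r \<and> integrable M Z \<and> expectation Z = 0"
    have "T x - Z x \<le> b powr (1 - r) * \<bar>Z x\<bar> powr r" for x
    proof (cases "\<bar>Z x\<bar> \<le> b")
      case False
      have "b powr (r - 1) \<le> \<bar>Z x\<bar> powr (r - 1)"
        using False * b by (intro powr_mono2) auto
      then have "b powr (1 - r) * b powr (r - 1) \<le> b powr (1 - r) * \<bar>Z x\<bar> powr (r - 1)"
        by (intro mult_left_mono) auto
      then have "1 \<le> b powr (1 - r) * \<bar>Z x\<bar> powr (r - 1)"
        using b by (simp add: powr_add[symmetric])
      then have "\<bar>Z x\<bar> * 1 \<le> \<bar>Z x\<bar> * (b powr (1 - r) * \<bar>Z x\<bar> powr (r - 1))"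
        by (intro mult_left_mono) auto
      also have "\<dots> = b powr (1 - r) * \<bar>Z x\<bar> powr r"
        using False b by (simp add: powr_diff)
      finally show ?thesis using False by (simp add: T_def)
    qed (simp add: T_def)
    then have "expectation (\<lambda>x. T x - Z x) \<le> expectation (\<lambda>x. b powr (1 - r) * \<bar>Z x\<bar> powr r)"
      using r * by (intro integral_mono T_int Bochner_Integration.integrable_diff) auto
    then show ?thesis using r * T_int by simp
  qed
  have "(T x)\<^sup>2 \<le> b powr (2 - r) * \<bar>Z x\<bar> powr r" for x
    using powr_split[of "\<bar>Z x\<bar>" 2] r by (auto simp: T_def)
  then have "expectation (\<lambda>x. (T x)\<^sup>2) \<le> expectation (\<lambda>x. b powr (2 - r) * \<bar>Z x\<bar> powr r)"
    using r by (intro integral_mono T2_int) auto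
  then have sq: "expectation (\<lambda>x. (T x)\<^sup>2) \<le> b powr (2 - r) * \<mu>"
    using r by simp
  have "exp (t * T x) \<le> 1 + t * T x + t\<^sup>2 * exp (t * b) * (T x)\<^sup>2" for x
  proof -
    have "\<bar>t * T x\<bar> \<le> t * b"
      using t T_bound by (simp add: abs_mult mult_left_mono)
    then have "(t * T x)\<^sup>2 * exp \<bar>t * T x\<bar> \<le> (t * T x)\<^sup>2 * exp (t * b)"
      by (intro mult_left_mono) auto
    then show ?thesis
      using exp_le_quadratic[of "t * T x"] by (simp add: power_mult_distrib mult_ac)
  qed
  then have "expectation (\<lambda>x. exp (t * T x))
      \<le> expectation (\<lambda>x. 1 + t * T x + t\<^sup>2 * exp (t * b) * (T x)\<^sup>2)"
    by (intro integral_mono exp_int Bochner_Integration.integrable_add integrable_mult_right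
        T_int T2_int integrable_const)
  also have "\<dots> = 1 + t * expectation T + t\<^sup>2 * exp (t * b) * expectation (\<lambda>x. (T x)\<^sup>2)"
    using T_int T2_int by (simp add: prob_space)
  also have "\<dots> \<le> 1 + t * (b powr (1 - r) * \<mu>) + t\<^sup>2 * exp (t * b) * (b powr (2 - r) * \<mu>)"
    using t by (intro add_mono mult_left_mono mean sq) auto
  also have "\<dots> = 1 + (t * b powr (1 - r) * \<mu> + t\<^sup>2 * b powr (2 - r) * \<mu> * exp (t * b))"
    by simp
  also have "\<dots> \<le> exp (t * b powr (1 - r) * \<mu> + t\<^sup>2 * b powr (2 - r) * \<mu> * exp (t * b))"
    by (rule exp_ge_add_one_self)
  finally show ?thesis by (simp add: T_def)
qed

text \<open>Chernoff's method: Markov's inequality for the exponential of \<open>t\<close> times the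
  sum, which factorises by independence.\<close>

lemma truncated_sum_upper_tail:
  assumes fin: "finite I" and ind: "indep_vars (\<lambda>_. borel) Z I"
    and r: "r \<le> 2" "\<And>k. k \<in> I \<Longrightarrow> integrable M (\<lambda>x. \<bar>Z k x\<bar> powr r)"
      "\<And>k. k \<in> I \<Longrightarrow> expectation (\<lambda>x. \<bar>Z k x\<bar> powr r) = \<mu>"
    and centred: "r \<le> 1 \<or> 1 \<le> r \<and> (\<forall>k\<in>I. integrable M (Z k) \<and> expectation (Z k) = 0)"
    and b: "b > 0" and t: "t \<ge> 0"
  shows "prob {x \<in> space M. s \<le> (\<Sum>k\<in>I. if \<bar>Z k x\<bar> \<le> b then Z k x else 0)}
    \<le> exp (real (card I) * (t * b powr (1 - r) * \<mu> + t\<^sup>2 * b powr (2 - r) * \<mu> * exp (t * b)) - t * s)"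
proof -
  define T where "T k x = (if \<bar>Z k x\<bar> \<le> b then Z k x else 0)" for k x
  define B where "B = t * b powr (1 - r) * \<mu> + t\<^sup>2 * b powr (2 - r) * \<mu> * exp (t * b)"
  have Z[measurable]: "random_variable borel (Z k)" if "k \<in> I" for k
    using ind that by (auto simp: indep_vars_def)
  have [measurable]: "random_variable borel (T k)" if "k \<in> I" for k
    unfolding T_def using that by measurable
  have indT: "indep_vars (\<lambda>_. borel) (\<lambda>k x. exp (t * T k x)) I"
    unfolding T_def by (rule indep_vars_compose2[OF ind]) measurable
  have exp_int: "integrable M (\<lambda>x. exp (t * T k x))" if "k \<in> I" for k
    using that by (intro integrable_const_bound[where B="exp (t * b)"])
       (use t b in \<open>auto intro!: AE_I2 mult_left_mono simp: T_def\<close>)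
  have expS: "exp (t * (\<Sum>k\<in>I. T k x)) = (\<Prod>k\<in>I. exp (t * T k x))" for x
    using fin by (simp add: sum_distrib_left exp_sum)
  have "prob {x \<in> space M. s \<le> (\<Sum>k\<in>I. T k x)}
      \<le> prob {x \<in> space M. (\<Prod>k\<in>I. exp (t * T k x)) \<ge> exp (t * s)}"
    using t by (intro finite_measure_mono) (auto simp: expS[symmetric] mult_left_mono)
  also have "\<dots> \<le> expectation (\<lambda>x. \<Prod>k\<in>I. exp (t * T k x)) / exp (t * s)"
    by (rule integral_Markov_inequality_measure[where A="{}"])
       (auto intro!: indep_vars_integrable fin indT exp_int prod_nonneg)
  also have "expectation (\<lambda>x. \<Prod>k\<in>I. exp (t * T k x)) = (\<Prod>k\<in>I. expectation (\<lambda>x. exp (t * T k x)))"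
    by (rule indep_vars_lebesgue_integral[OF fin indT exp_int])
  also have "\<dots> \<le> (\<Prod>k\<in>I. exp B)"
    unfolding T_def B_def using centred
    by (intro prod_mono conjI truncated_exp_moment integral_nonneg_AE r b t Z) auto
  also have "\<dots> = exp (real (card I) * B)"
    by (simp add: exp_of_nat_mult)
  finally show ?thesis
    by (simp add: T_def B_def exp_diff divide_right_mono)
qed

text \<open>Truncation is symmetric, so it commutes with negation and the one-sided bound applies to
  \<open>Z\<close> and to its negative.\<close>

lemma truncated_sum_tail:
  assumes fin: "finite I" and ind: "indep_vars (\<lambda>_. borel) Z I"
    and r: "r \<le> 2" "\<And>k. k \<in> I \<Longrightarrow> integrable M (\<lambda>x. \<bar>Z k x\<bar> powr r)"
      "\<And>k. k \<in> I \<Longrightarrow> expectation (\<lambda>x. \<bar>Z k x\<bar> powr r) = \<mu>"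
    and centred: "r \<le> 1 \<or> 1 \<le> r \<and> (\<forall>k\<in>I. integrable M (Z k) \<and> expectation (Z k) = 0)"
    and b: "b > 0" and t: "t \<ge> 0"
  shows "prob {x \<in> space M. s \<le> \<bar>\<Sum>k\<in>I. if \<bar>Z k x\<bar> \<le> b then Z k x else 0\<bar>}
    \<le> 2 * exp (real (card I) * (t * b powr (1 - r) * \<mu> + t\<^sup>2 * b powr (2 - r) * \<mu> * exp (t * b)) - t * s)"
    (is "_ \<le> 2 * ?B")
proof -
  have Z[measurable]: "random_variable borel (Z k)" if "k \<in> I" for k
    using ind that by (auto simp: indep_vars_def)
  let ?S = "\<lambda>Z x. \<Sum>k\<in>I. if \<bar>Z k x\<bar> \<le> b then Z k x else (0::real)"
  let ?Y = "\<lambda>k x. - Z k x"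
  have indY: "indep_vars (\<lambda>_. borel) ?Y I"
    by (rule indep_vars_compose2[OF ind]) measurable
  have neg: "?S ?Y x = - ?S Z x" for x
    unfolding sum_negf[symmetric] by (intro sum.cong) auto
  have "prob {x \<in> space M. s \<le> \<bar>?S Z x\<bar>}
      \<le> prob ({x \<in> space M. s \<le> ?S Z x} \<union> {x \<in> space M. s \<le> ?S ?Y x})"
    unfolding neg by (intro finite_measure_mono) auto
  also have "\<dots> \<le> prob {x \<in> space M. s \<le> ?S Z x} + prob {x \<in> space M. s \<le> ?S ?Y x}"
    unfolding neg by (intro measure_Un_le) auto
  also have "prob {x \<in> space M. s \<le> ?S Z x} \<le> ?B"
    by (rule truncated_sum_upper_tail[OF fin ind r centred b t])
  also have "prob {x \<in> space M. s \<le> ?S ?Y x} \<le> ?B"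
    by (rule truncated_sum_upper_tail[OF fin indY]) (use r centred b t in auto)
  finally show ?thesis by simp
qed

text \<open>The second Borel-Cantelli lemma, stated in terms of the complements.\<close>
lemma indep_events_eventually_imp_summable:
  assumes ind: "indep_events B (UNIV :: nat set)"
    and ev: "AE x in M. eventually (\<lambda>n. x \<in> B n) sequentially"
  shows "summable (\<lambda>n. 1 - prob (B n))"
proof (rule ccontr)
  assume ns: "\<not> summable (\<lambda>n. 1 - prob (B n))"
  have [measurable]: "B n \<in> events" for n
    using ind by (auto simp: indep_events_def)
  have zero: "prob (\<Inter>n\<in>{N..}. B n) = 0" for N
  proof -
    let ?P = "prob (\<Inter>n\<in>{N..}. B n)"
    \<comment> \<open>With ?s the partial sum, independence gives ?P \<le> exp (- ?s), and ?s \<le>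
      exp ?s. A positive ?P would therefore bound all partial sums by 1 / ?P.\<close>
    have bound: "(\<Sum>n<m. 1 - prob (B (n + N))) * ?P \<le> 1" for m
    proof (cases "m = 0")
      case False
      let ?s = "\<Sum>n<m. 1 - prob (B (n + N))"
      have "?P \<le> prob (\<Inter>n\<in>{N..<m+N}. B n)"
        using False by (intro finite_measure_mono sets.finite_INT) auto
      also have "\<dots> = (\<Prod>n\<in>{N..<m+N}. prob (B n))"
        using ind False by (simp add: indep_events_def)
      also have "\<dots> = (\<Prod>n<m. prob (B (n + N)))"
        by (rule prod.reindex_bij_witness[where i="\<lambda>n. n + N" and j="\<lambda>n. n - N"]) auto
      also have "\<dots> \<le> (\<Prod>n<m. exp (- (1 - prob (B (n + N)))))"
        using exp_ge_add_one_self[of "- (1 - prob (B (n + N)))" for n]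
        by (intro prod_mono) auto
      also have "\<dots> = exp (- ?s)"
        by (simp add: exp_sum sum_negf[symmetric])
      finally have "?P \<le> exp (- ?s)" .
      then have "?P * exp ?s \<le> 1"
        by (simp add: exp_minus field_simps)
      moreover have "?s * ?P \<le> exp ?s * ?P"
        using exp_ge_add_one_self[of ?s] by (intro mult_right_mono measure_nonneg) linarith
      ultimately show ?thesis by (simp add: mult.commute)
    qed simp
    show ?thesis
    proof (rule ccontr)
      assume "?P \<noteq> 0"
      then have pos: "?P > 0"
        using measure_nonneg[of M "\<Inter>n\<in>{N..}. B n"] by linarith
      have "summable (\<lambda>n. 1 - prob (B (n + N)))"
      proof (rule bounded_imp_summable)
        show "(\<Sum>n\<le>m. 1 - prob (B (n + N))) \<le> 1 / ?P" for m
          using bound[of "Suc m"] pos by (simp add: field_simps lessThan_Suc_atMost)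
      qed simp
      then show False using ns summable_iff_shift[of "\<lambda>n. 1 - prob (B n)" N] by simp
    qed
  qed
  have "AE x in M. \<forall>N. x \<notin> (\<Inter>n\<in>{N..}. B n)"
    unfolding AE_all_countable
  proof
    fix N
    have "(\<Inter>n\<in>{N..}. B n) \<in> null_sets M"
      using zero by (simp add: null_sets_def emeasure_eq_measure)
    then show "AE x in M. x \<notin> (\<Inter>n\<in>{N..}. B n)"
      by (rule AE_not_in)
  qed
  with ev have "AE x in M. False"
    by eventually_elim (auto simp: eventually_sequentially)
  then show False by simp
qed

text \<open>The square of \<open>Z\<close> is compared pointwise with the sum \<open>G\<close> of
  all n with n \<le> Z, which is m (m + 1) / 2 for m the integer part of \<open>Z\<close>. The
  expectation of \<open>G\<close> is the given series.\<close>

lemma integrable_square_of_tail_sum: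
  fixes Z :: "'a \<Rightarrow> real"
  assumes [measurable]: "random_variable borel Z" and nonneg: "\<And>x. 0 \<le> Z x"
    and tails: "summable (\<lambda>n. real n * prob {x \<in> space M. real n \<le> Z x})"
  shows "integrable M (\<lambda>x. (Z x)\<^sup>2)"
proof (rule integrableI_bounded)
  define G where "G x = (\<Sum>n. ennreal (real n) * indicator {x \<in> space M. real n \<le> Z x} x)" for x
  have [measurable]: "G \<in> borel_measurable M"
    unfolding G_def by measurable
  have bound: "ennreal ((Z x)\<^sup>2) \<le> 2 + 4 * G x" if x: "x \<in> space M" for x
  proof -
    define m where "m = nat \<lfloor>Z x\<rfloor>"
    have m: "real m \<le> Z x" "Z x < real m + 1"
      unfolding m_def using nonneg[of x] by linarith+
    have gauss: "2 * (\<Sum>n\<le>m. real n) = real m * (real m + 1)"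
      by (induction m) (auto simp: algebra_simps)
    have "(Z x)\<^sup>2 \<le> (real m + 1)\<^sup>2"
      using m nonneg[of x] by (intro power_mono) auto
    \<comment> \<open>The difference of the two sides is the square of m - 1.\<close>
    also have "\<dots> \<le> 2 + 2 * (real m)\<^sup>2"
      using sum_power2_ge_zero[of "real m - 1" 0] by (simp add: power2_eq_square algebra_simps)
    also have "\<dots> \<le> 2 + 4 * (\<Sum>n\<le>m. real n)"
      using gauss by (simp add: power2_eq_square algebra_simps)
    finally have "ennreal ((Z x)\<^sup>2) \<le> ennreal (2 + 4 * (\<Sum>n\<le>m. real n))"
      by (rule ennreal_leI)
    also have "\<dots> = 2 + 4 * (\<Sum>n\<le>m. ennreal (real n))"
      by (simp add: ennreal_plus ennreal_mult sum_nonneg sum_ennreal del: of_nat_sum)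
    also have "(\<Sum>n\<le>m. ennreal (real n))
        = (\<Sum>n\<le>m. ennreal (real n) * indicator {x \<in> space M. real n \<le> Z x} x)"
      using x m by (intro sum.cong) auto
    also have "\<dots> \<le> G x"
      unfolding G_def by (rule sum_le_suminf) auto
    finally show ?thesis by (simp add: mult_left_mono add_left_mono)
  qed
  have "(\<integral>\<^sup>+x. ennreal (norm ((Z x)\<^sup>2)) \<partial>M) \<le> (\<integral>\<^sup>+x. 2 + 4 * G x \<partial>M)"
    using bound by (intro nn_integral_mono) simp
  also have "\<dots> = 2 + 4 * (\<integral>\<^sup>+x. G x \<partial>M)"
    by (simp add: nn_integral_add nn_integral_cmult emeasure_space_1)
  also have "(\<integral>\<^sup>+x. G x \<partial>M) = (\<Sum>n. ennreal (real n * prob {x \<in> space M. real n \<le> Z x}))"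
    unfolding G_def by (subst nn_integral_suminf)
      (auto simp: nn_integral_cmult emeasure_eq_measure ennreal_mult)
  also have "\<dots> = ennreal (\<Sum>n. real n * prob {x \<in> space M. real n \<le> Z x})"
    by (rule suminf_ennreal2[OF _ tails]) simp
  also have "2 + 4 * \<dots> < \<infinity>"
    by (simp add: ennreal_mult_less_top)
  finally show "(\<integral>\<^sup>+x. ennreal (norm ((Z x)\<^sup>2)) \<partial>M) < \<infinity>" .
qed simp

text \<open>In the induction step the new summand is independent of the old sum and centred, so the
  cross term has mean zero.\<close>

lemma indep_centred_sum_square:
  fixes W :: "'i \<Rightarrow> 'a \<Rightarrow> real"
  assumes fin: "finite I" and ind: "indep_vars (\<lambda>_. borel) W I"
    and int: "\<And>k. k \<in> I \<Longrightarrow> integrable M (W k)" "\<And>k. k \<in> I \<Longrightarrow> integrable M (\<lambda>x. (W k x)\<^sup>2)"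
    and mean: "\<And>k. k \<in> I \<Longrightarrow> expectation (W k) = 0"
    and sq: "\<And>k. k \<in> I \<Longrightarrow> expectation (\<lambda>x. (W k x)\<^sup>2) = v"
  shows "integrable M (\<lambda>x. (\<Sum>k\<in>I. W k x)\<^sup>2) \<and>
    expectation (\<lambda>x. (\<Sum>k\<in>I. W k x)\<^sup>2) = real (card I) * v"
  using fin ind int mean sq
proof (induction I)
  case (insert i I)
  let ?S = "\<lambda>x. \<Sum>k\<in>I. W k x"
  have IH: "integrable M (\<lambda>x. (?S x)\<^sup>2)" "expectation (\<lambda>x. (?S x)\<^sup>2) = real (card I) * v"
    using insert.IH indep_vars_subset[OF insert.prems(1)] insert.prems by auto
  have iv: "indep_var borel (W i) borel ?S"
    using insert by (intro indep_vars_sum) auto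
  have S: "integrable M ?S"
    using insert.prems by auto
  have prod: "integrable M (\<lambda>x. W i x * ?S x)" "expectation (\<lambda>x. W i x * ?S x) = 0"
    using indep_var_integrable[OF iv _ S] indep_var_lebesgue_integral[OF iv _ S] insert.prems by auto
  have eq: "(\<Sum>k\<in>insert i I. W k x)\<^sup>2 = (W i x)\<^sup>2 + (2 * (W i x * ?S x) + (?S x)\<^sup>2)" for x
    using insert.hyps by (simp add: power2_sum)
  show ?case
    unfolding eq using insert IH prod by (simp add: algebra_simps)
qed simp

text \<open>The squared centred averages \<open>D n\<close> tend to the square of \<open>m\<close>
  almost surely, while their means (v - m^2) / n tend to 0. Fatou's lemma then forces m = 0.\<close>

lemma mean_zero_of_averages_tendsto_zero:
  fixes Z :: "nat \<Rightarrow> 'a \<Rightarrow> real"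
  assumes ind: "indep_vars (\<lambda>_. borel) Z {1..}"
    and int: "\<And>k. k \<ge> 1 \<Longrightarrow> integrable M (Z k)" "\<And>k. k \<ge> 1 \<Longrightarrow> integrable M (\<lambda>x. (Z k x)\<^sup>2)"
    and mean: "\<And>k. k \<ge> 1 \<Longrightarrow> expectation (Z k) = m"
    and sq: "\<And>k. k \<ge> 1 \<Longrightarrow> expectation (\<lambda>x. (Z k x)\<^sup>2) = v"
    and lim: "AE x in M. (\<lambda>n. (\<Sum>k=1..n. Z k x) / real n) \<longlonglongrightarrow> 0"
  shows "m = 0"
proof -
  define W where "W k x = Z k x - m" for k x
  define D where "D n x = ((\<Sum>k=1..n. W k x) / real n)\<^sup>2" for n x
  have indW: "indep_vars (\<lambda>_. borel) W {1..n}" for n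
    unfolding W_def
    by (rule indep_vars_compose2[OF indep_vars_subset[OF ind]]) auto
  have W: "integrable M (W k)" "integrable M (\<lambda>x. (W k x)\<^sup>2)" "expectation (W k) = 0"
      "expectation (\<lambda>x. (W k x)\<^sup>2) = v - m\<^sup>2" if "k \<ge> 1" for k
  proof -
    have sqW: "(W k x)\<^sup>2 = (Z k x)\<^sup>2 + m\<^sup>2 - 2 * m * Z k x" for x
      by (simp add: W_def power2_diff)
    show "integrable M (\<lambda>x. (W k x)\<^sup>2)" "expectation (\<lambda>x. (W k x)\<^sup>2) = v - m\<^sup>2"
      unfolding sqW using int[OF that] mean[OF that] sq[OF that]
      by (simp_all add: prob_space power2_eq_square)
    show "integrable M (W k)" "expectation (W k) = 0"
      using int[OF that] mean[OF that] by (simp_all add: W_def[abs_def] prob_space)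
  qed
  have D: "integrable M (D n)" "expectation (D n) = (v - m\<^sup>2) / real n" for n
    using indep_centred_sum_square[OF _ indW, of n "v - m\<^sup>2"] W
    by (auto simp: D_def[abs_def] power_divide power2_eq_square)
  have "AE x in M. ennreal (m\<^sup>2) = liminf (\<lambda>n. ennreal (D n x))"
    using lim
  proof eventually_elim
    case (elim x)
    have "(\<lambda>n. ((\<Sum>k=1..n. Z k x) / real n - m)\<^sup>2) \<longlonglongrightarrow> (0 - m)\<^sup>2"
      by (intro tendsto_intros elim)
    moreover have "eventually (\<lambda>n. ((\<Sum>k=1..n. Z k x) / real n - m)\<^sup>2 = D n x) sequentially"
      using eventually_gt_at_top[of 0]
      by eventually_elim (simp add: D_def W_def sum_subtractf diff_divide_distrib)
    ultimately have "(\<lambda>n. D n x) \<longlonglongrightarrow> m\<^sup>2"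
      by (simp add: filterlim_cong)
    then show ?case
      by (intro lim_imp_Liminf[symmetric] tendsto_ennrealI) auto
  qed
  then have "ennreal (m\<^sup>2) = (\<integral>\<^sup>+x. liminf (\<lambda>n. ennreal (D n x)) \<partial>M)"
    by (subst nn_integral_cong_AE[symmetric]) (auto simp: emeasure_space_1)
  also have "\<dots> \<le> liminf (\<lambda>n. \<integral>\<^sup>+x. ennreal (D n x) \<partial>M)"
    using D(1) by (intro nn_integral_liminf) auto
  also have "(\<lambda>n. \<integral>\<^sup>+x. ennreal (D n x) \<partial>M) = (\<lambda>n. ennreal ((v - m\<^sup>2) / real n))"
    using D by (subst nn_integral_eq_integral) (auto simp: D_def)
  also have "liminf \<dots> = 0"
  proof (rule lim_imp_Liminf)
    have "(\<lambda>n. (v - m\<^sup>2) / real n) \<longlonglongrightarrow> 0"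
      by (rule lim_const_over_n)
    then show "(\<lambda>n. ennreal ((v - m\<^sup>2) / real n)) \<longlonglongrightarrow> 0"
      using tendsto_ennrealI by fastforce
  qed simp
  finally show ?thesis by simp
qed

end

section \<open>Sequences of independent identically distributed pairs\<close>

text \<open>The random vectors take values in \<open>borel\<close> on the plane.
  \<open>borel_prod\<close> identifies it with the product sigma-algebra, for which projections are
  measurable.\<close>

lemma borel_measurable_fst: "fst \<in> (borel :: (real \<times> real) measure) \<rightarrow>\<^sub>M borel"
  unfolding borel_prod[symmetric] by (rule measurable_fst)

lemma borel_measurable_snd: "snd \<in> (borel :: (real \<times> real) measure) \<rightarrow>\<^sub>M borel"
  unfolding borel_prod[symmetric] by (rule measurable_snd)

text \<open>An abstract index set lets rows of the array, and any other finite selection, be handled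
  as plain subsets of one family. The two components at the same index may depend on each
  other.\<close>

locale iid_pairs = prob_space M for M :: "'s measure" +
  fixes X Y :: "'i \<Rightarrow> 's \<Rightarrow> real" and I :: "'i set"
  assumes infinite_index: "infinite I"
    and indep: "indep_vars (\<lambda>_. borel) (\<lambda>a x. (X a x, Y a x)) I"
    and ident: "\<And>a b. a \<in> I \<Longrightarrow> b \<in> I \<Longrightarrow>
      distr M borel (\<lambda>x. (X a x, Y a x)) = distr M borel (\<lambda>x. (X b x, Y b x))"
begin

lemma rv_pair [measurable]: "a \<in> I \<Longrightarrow> random_variable borel (\<lambda>x. (X a x, Y a x))"
  using indep by (auto simp: indep_vars_def)

lemma rv_X [measurable]: "a \<in> I \<Longrightarrow> random_variable borel (X a)"
  using measurable_compose[OF rv_pair borel_measurable_fst] by simp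

lemma rv_Y [measurable]: "a \<in> I \<Longrightarrow> random_variable borel (Y a)"
  using measurable_compose[OF rv_pair borel_measurable_snd] by simp

text \<open>The setting is symmetric in the components, so each fact about \<open>X\<close> yields
  one about \<open>Y\<close>.\<close>

lemma iid_pairs_swap: "iid_pairs M Y X I"
proof
  have swap: "(\<lambda>(u, v). (v, u)) \<in> borel \<rightarrow>\<^sub>M (borel :: (real \<times> real) measure)"
    unfolding borel_prod[symmetric] by measurable
  show "indep_vars (\<lambda>_. borel) (\<lambda>a x. (Y a x, X a x)) I"
    using indep_vars_compose2[OF indep, of "\<lambda>_ (u, v). (v, u)"] swap by simp
  show "distr M borel (\<lambda>x. (Y a x, X a x)) = distr M borel (\<lambda>x. (Y b x, X b x))"
    if "a \<in> I" "b \<in> I" for a b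
    using arg_cong[OF ident[OF that], of "\<lambda>N. distr N borel (\<lambda>(u, v). (v, u))"] that
    by (simp add: distr_distr[OF swap] comp_def)
qed (rule infinite_index)

lemma distr_X: "distr M borel (X a) = distr M borel (X b)" if "a \<in> I" "b \<in> I"
  using arg_cong[OF ident[OF that], of "\<lambda>N. distr N borel fst"] that
  by (simp add: distr_distr[OF borel_measurable_fst] comp_def)

lemma distr_Y: "distr M borel (Y a) = distr M borel (Y b)" if "a \<in> I" "b \<in> I"
  by (rule iid_pairs.distr_X[OF iid_pairs_swap that])

text \<open>Both components are functions of the restrictions of the family to the disjoint sets {a}
  and {b}.\<close>

lemma indep_var_XY:
  assumes "a \<in> I" "b \<in> I" "a \<noteq> b"
  shows "indep_var borel (X a) borel (Y b)"
proof -
  have fst: "(\<lambda>w. fst (w a)) \<in> PiM {a} (\<lambda>_. borel :: (real \<times> real) measure) \<rightarrow>\<^sub>M (borel :: real measure)"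
    using measurable_compose[OF measurable_component_singleton[of a "{a}" "\<lambda>_. borel"] borel_measurable_fst] by simp
  have snd: "(\<lambda>w. snd (w b)) \<in> PiM {b} (\<lambda>_. borel :: (real \<times> real) measure) \<rightarrow>\<^sub>M (borel :: real measure)"
    using measurable_compose[OF measurable_component_singleton[of b "{b}" "\<lambda>_. borel"] borel_measurable_snd] by simp
  have "indep_var (PiM {a} (\<lambda>_. borel)) (\<lambda>x. \<lambda>i\<in>{a}. (X i x, Y i x))
      (PiM {b} (\<lambda>_. borel)) (\<lambda>x. \<lambda>i\<in>{b}. (X i x, Y i x))"
    using assms by (intro indep_var_restrict[OF indep]) auto
  from indep_var_compose[OF this fst snd] show ?thesis
    by (simp add: comp_def)
qed

text \<open>For distinct indices the law of the product is determined by the two marginal laws,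
  which are the same at all indices.\<close>

lemma distr_XY:
  assumes "a \<in> I" "b \<in> I" "a \<noteq> b" "a' \<in> I" "b' \<in> I" "a' \<noteq> b'"
  shows "distr M borel (\<lambda>x. X a x * Y b x) = distr M borel (\<lambda>x. X a' x * Y b' x)"
proof -
  have "distr M borel (\<lambda>x. X a x * Y b x)
      = distr (distr M borel (X a) \<Otimes>\<^sub>M distr M borel (Y b)) borel (\<lambda>(u, v). u * v)"
    if "a \<in> I" "b \<in> I" "a \<noteq> b" for a b
    using indep_var_XY[OF that] that
    by (simp add: indep_var_distribution_eq distr_distr comp_def)
  then show ?thesis
    using assms by (simp add: distr_X[OF assms(1,4)] distr_Y[OF assms(2,5)])
qed

section \<open>Exceedance events and exchangeability\<close>

definition exceed :: "'i set \<Rightarrow> real \<Rightarrow> 's set" where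
  "exceed J t = {x \<in> space M. \<exists>a\<in>J. \<exists>b\<in>J. a \<noteq> b \<and> t \<le> \<bar>X a x * Y b x\<bar>}"

lemma exceed_events [measurable]:
  assumes "J \<subseteq> I" "finite J" shows "exceed J t \<in> events"
proof -
  have [simp]: "a \<in> I" if "a \<in> J" for a using that assms by auto
  show ?thesis
    unfolding exceed_def using assms(2) by measurable
qed

lemma indep_reindex:
  assumes "inj_on g L" "g ` L \<subseteq> I"
  shows "indep_vars (\<lambda>_. borel) (\<lambda>l x. (X (g l) x, Y (g l) x)) L"
proof -
  have "indep_vars (\<lambda>l. PiM {g l} (\<lambda>_. borel)) (\<lambda>l x. \<lambda>i\<in>{g l}. (X i x, Y i x)) L"
    using assms by (intro indep_vars_restrict[OF indep])
      (auto simp: disjoint_family_on_def inj_on_def)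
  from indep_vars_compose2[OF this, of "\<lambda>l w. w (g l)" "\<lambda>_. borel"] show ?thesis
    by simp
qed

text \<open>Exchangeability: enumerated along a bijection, both events become the same set
  \<open>A\<close> of configurations over \<open>L\<close>, and both families have the same product
  law.\<close>

lemma prob_exceed_cong:
  assumes L: "L \<subseteq> I" "finite L" and L': "L' \<subseteq> I" "finite L'" and card: "card L = card L'"
  shows "prob (exceed L t) = prob (exceed L' t)"
proof (cases "L = {}")
  case True
  then show ?thesis using card L' by (simp add: exceed_def)
next
  case False
  obtain g where g: "bij_betw g L L'"
    using L L' card by (metis finite_same_card_bij)
  let ?P = "PiM L (\<lambda>_. borel :: (real \<times> real) measure)"
  define A where "A = {w \<in> space ?P. \<exists>a\<in>L. \<exists>b\<in>L. a \<noteq> b \<and> t \<le> \<bar>fst (w a) * snd (w b)\<bar>}"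
  \<comment> \<open>Measurability is shown for the product sigma-algebra on the plane, where
    coordinates can be taken, and then transferred to \<open>borel\<close>.\<close>
  have "A \<in> sets (PiM L (\<lambda>_. borel \<Otimes>\<^sub>M borel))"
    unfolding A_def borel_prod[symmetric] using L(2) by measurable
  then have A[measurable]: "A \<in> sets ?P"
    by (simp add: borel_prod)
  have law: "prob (exceed (h ` L) t) = measure (PiM L (\<lambda>l. distr M borel (\<lambda>x. (X l x, Y l x)))) A"
    if h: "inj_on h L" "h ` L \<subseteq> I" for h
  proof -
    have [measurable]: "random_variable borel (\<lambda>x. (X (h l) x, Y (h l) x))" if "l \<in> L" for l
      using h that by auto
    let ?W = "\<lambda>x. \<lambda>l\<in>L. (X (h l) x, Y (h l) x)"
    have "exceed (h ` L) t = ?W -` A \<inter> space M"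
      using h(1) by (auto simp: exceed_def A_def space_PiM inj_on_def) metis
    then have "prob (exceed (h ` L) t) = measure (distr M ?P ?W) A"
      by (simp add: measure_distr)
    also have "distr M ?P ?W = PiM L (\<lambda>l. distr M borel (\<lambda>x. (X (h l) x, Y (h l) x)))"
      using indep_vars_iff_distr_eq_PiM'[OF False,
          where M' = "\<lambda>_. borel" and X = "\<lambda>l x. (X (h l) x, Y (h l) x)"]
        indep_reindex[OF h] by simp
    also have "\<dots> = PiM L (\<lambda>l. distr M borel (\<lambda>x. (X l x, Y l x)))"
      using h L by (intro PiM_cong ident) auto
    finally show ?thesis .
  qed
  show ?thesis
    using law[of "\<lambda>l. l"] law[of g] g L L' by (simp add: bij_betw_def)
qed

text \<open>The choice of \<open>J\<close> does not matter: see \<open>prob_exceed\<close> below.\<close>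
definition exceed_prob :: "nat \<Rightarrow> real \<Rightarrow> real" where
  "exceed_prob n t = prob (exceed (SOME J. J \<subseteq> I \<and> finite J \<and> card J = n) t)"

lemma prob_exceed:
  assumes "J \<subseteq> I" "finite J" shows "prob (exceed J t) = exceed_prob (card J) t"
proof -
  have "\<exists>J'. J' \<subseteq> I \<and> finite J' \<and> card J' = card J" using assms by auto
  from someI_ex[OF this] assms show ?thesis
    unfolding exceed_prob_def by (intro prob_exceed_cong) auto
qed

lemma obtain_index_set:
  obtains J where "J \<subseteq> I" "finite J" "card J = n"
  using infinite_arbitrarily_large[OF infinite_index] by metis

lemma exceed_prob_mono: "exceed_prob n t \<le> exceed_prob m t'" if "n \<le> m" "t' \<le> t"
proof -
  obtain J where J: "J \<subseteq> I" "finite J" "card J = m" by (rule obtain_index_set)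
  obtain J' where J': "J' \<subseteq> J" "card J' = n" 
    using J \<open>n \<le> m\<close> by (metis obtain_subset_with_card_n)
  have "prob (exceed J' t) \<le> prob (exceed J t')"
    using J J' that by (intro finite_measure_mono exceed_events) (auto simp: exceed_def, fastforce)
  moreover have "J' \<subseteq> I" "finite J'" using J J' by (auto intro: finite_subset)
  ultimately show ?thesis using J J' by (simp add: prob_exceed)
qed

lemma exceed_prob_nonneg: "0 \<le> exceed_prob n t"
  by (simp add: exceed_prob_def)

text \<open>Cut the index set into \<open>R\<close> blocks of size \<open>h\<close>: any two indices lie in the union of two blocks.\<close>
lemma exceed_prob_blocks:
  assumes "n \<le> R * h" "2 * h \<le> m"
  shows "exceed_prob n t \<le> (real R)\<^sup>2 * exceed_prob m t"
proof -
  obtain J where J: "J \<subseteq> I" "finite J" "card J = n" by (rule obtain_index_set)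
  obtain e where e: "bij_betw e J {..<n}"
    using J by (metis finite_same_card_bij card_lessThan finite_lessThan)
  define c where "c a = e a div h" for a
  define L where "L u v = {a \<in> J. c a = u \<or> c a = v}" for u v
  have c: "c a < R" if "a \<in> J" for a
  proof -
    have "e a < R * h" using bij_betwE[OF e] that assms by fastforce
    then show ?thesis
      unfolding c_def by (simp add: less_mult_imp_div_less)
  qed
  have L: "L u v \<subseteq> I" "finite (L u v)" for u v
    using J by (auto simp: L_def)
  have card_L: "card (L u v) \<le> m" for u v
  proof (cases "h = 0")
    \<comment> \<open>Now n \<le> R * 0, so \<open>J\<close> is empty.\<close>
    case True
    then show ?thesis using assms J by (simp add: L_def)
  next
    case False
    have block: "card {a \<in> J. c a = u} \<le> h" for u
    proof -
      have "card {a \<in> J. c a = u} = card (e ` {a \<in> J. c a = u})"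
        using e by (intro card_image[symmetric]) (auto simp: bij_betw_def inj_on_def)
      also have "\<dots> \<le> card {u * h..<u * h + h}"
        using False by (intro card_mono) (auto simp: c_def div_nat_eqI dividend_less_div_times add.commute)
      finally show ?thesis by simp
    qed
    have "card (L u v) \<le> card ({a \<in> J. c a = u} \<union> {a \<in> J. c a = v})"
      using J by (intro card_mono) (auto simp: L_def)
    also have "\<dots> \<le> h + h"
      using card_Un_le[of "{a \<in> J. c a = u}" "{a \<in> J. c a = v}"] block[of u] block[of v] by linarith
    finally show ?thesis using assms by simp
  qed
  have "exceed_prob n t = prob (exceed J t)" using J by (simp add: prob_exceed)
  also have "\<dots> \<le> prob (\<Union>w\<in>{..<R} \<times> {..<R}. exceed (L (fst w) (snd w)) t)"
    using L c by (intro finite_measure_mono sets.finite_UN exceed_events)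
      (auto simp: exceed_def L_def, blast)
  also have "\<dots> \<le> (\<Sum>w\<in>{..<R} \<times> {..<R}. prob (exceed (L (fst w) (snd w)) t))"
    using L by (intro finite_measure_subadditive_finite) (auto intro: exceed_events)
  also have "\<dots> \<le> (\<Sum>w\<in>{..<R} \<times> {..<R}. exceed_prob m t)"
    using L card_L by (intro sum_mono) (simp add: prob_exceed exceed_prob_mono)
  also have "\<dots> = (real R)\<^sup>2 * exceed_prob m t"
    by (simp add: power2_eq_square)
  finally show ?thesis .
qed

text \<open>The block bound with blocks of size \<open>m div 2\<close>. The factor 3 comes from m
  \<le> 3 (m div 2), which is sharp at m = 3.\<close>

lemma exceed_prob_scale: "exceed_prob n t \<le> (3 * real c)\<^sup>2 * exceed_prob m t" if "2 \<le> m" "n \<le> c * m"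
proof -
  have "m \<le> 3 * (m div 2)" using that by linarith
  then have "c * m \<le> c * (3 * (m div 2))" by (rule mult_le_mono2)
  then have "n \<le> (c * 3) * (m div 2)" using le_trans[OF that(2)] by (simp only: mult.assoc)
  from exceed_prob_blocks[OF this, of m t] show ?thesis by (simp add: mult.commute)
qed

section \<open>Moments from summable exceedance probabilities\<close>

text \<open>If |Y b| \<ge> e and one of n other indices has |X| \<ge> s / e, then a product reaches
  s. Independence across indices makes the probability explicit; \<open>a\<close> merely names the
  common law of \<open>X\<close>.\<close>

lemma exceed_prob_lower_bound:
  assumes "a \<in> I" "b \<in> I" and e: "0 < e"
  shows "prob {x \<in> space M. e \<le> \<bar>Y b x\<bar>}
      * (1 - (1 - prob {x \<in> space M. s / e \<le> \<bar>X a x\<bar>}) ^ n) \<le> exceed_prob (Suc n) s"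
proof -
  obtain L where L: "L \<subseteq> I - {b}" "finite L" "card L = n"
    using infinite_arbitrarily_large[of "I - {b}" n] infinite_index by auto
  have [measurable]: "random_variable borel (X l)" "random_variable borel (Y l)" if "l \<in> insert b L" for l
    using L assms that by auto
  \<comment> \<open>One set per pair, so that "|Y b| is large and all other |X l| are small" is a
    single box event to which independence applies.\<close>
  define A where "A l = (if l = b then {z. e \<le> \<bar>snd z\<bar>} else {z :: real \<times> real. \<bar>fst z\<bar> < s / e})" for l
  define E where "E = {x \<in> space M. e \<le> \<bar>Y b x\<bar>}"
  define p where "p = prob {x \<in> space M. s / e \<le> \<bar>X a x\<bar>}"
  have [measurable]: "E \<in> events" unfolding E_def by measurable
  have A: "A l \<in> sets borel" for l
    unfolding A_def
    by (auto intro!: borel_closed[OF closed_Collect_le] borel_open[OF open_Collect_less] continuous_intros)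
  have W: "(\<lambda>x. (X b x, Y b x)) -` A b \<inter> space M = E"
    by (auto simp: A_def E_def)
  have small: "prob ((\<lambda>x. (X l x, Y l x)) -` A l \<inter> space M) = 1 - p" if "l \<in> L" for l
  proof -
    have l: "l \<in> I" "l \<noteq> b" using L that by auto
    have eq: "prob {x \<in> space M. \<bar>X c x\<bar> < s / e} = measure (distr M borel (X c)) {u. \<bar>u\<bar> < s / e}"
      if "c \<in> I" for c
      using that by (subst measure_distr) (auto intro!: arg_cong[where f=prob])
    have "prob ((\<lambda>x. (X l x, Y l x)) -` A l \<inter> space M) = prob {x \<in> space M. \<bar>X l x\<bar> < s / e}"
      using l by (intro arg_cong[where f=prob]) (auto simp: A_def)
    also have "\<dots> = prob {x \<in> space M. \<bar>X a x\<bar> < s / e}"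
      using l assms by (simp add: eq distr_X[of l a])
    also have "\<dots> = prob (space M - {x \<in> space M. s / e \<le> \<bar>X a x\<bar>})"
      by (intro arg_cong[where f=prob]) auto
    also have "\<dots> = 1 - p"
      unfolding p_def using assms by (intro prob_compl) auto
    finally show ?thesis .
  qed
  let ?D = "\<Inter>l\<in>insert b L. (\<lambda>x. (X l x, Y l x)) -` A l \<inter> space M"
  have "prob ?D = (\<Prod>l\<in>insert b L. prob ((\<lambda>x. (X l x, Y l x)) -` A l \<inter> space M))"
    using L assms A by (intro indep_varsD[OF indep]) auto
  also have "\<dots> = prob E * (\<Prod>l\<in>L. prob ((\<lambda>x. (X l x, Y l x)) -` A l \<inter> space M))"
    using L by (subst prod.insert) (auto simp: W)
  also have "\<dots> = prob E * (1 - p) ^ n"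
    using L by (simp add: small)
  finally have D: "prob ?D = prob E * (1 - p) ^ n" .
  have Dm: "?D \<in> events"
    using L A assms by (intro sets.finite_INT measurable_sets[OF rv_pair]) auto
  have "prob E * (1 - (1 - p) ^ n) = prob E - prob ?D"
    unfolding D by (simp add: algebra_simps)
  also have "\<dots> = prob (E - ?D)"
    using Dm W by (intro finite_measure_Diff[symmetric]) auto
  also have "\<dots> \<le> prob (exceed (insert b L) s)"
  proof (rule finite_measure_mono)
    show "exceed (insert b L) s \<in> events"
      using L assms by (intro exceed_events) auto
    show "E - ?D \<subseteq> exceed (insert b L) s"
    proof
      fix x assume x: "x \<in> E - ?D"
      then have "x \<in> space M" "e \<le> \<bar>Y b x\<bar>" "\<exists>l\<in>L. \<not> \<bar>X l x\<bar> < s / e"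
        by (auto simp: A_def E_def split: if_splits)
      then obtain l where l: "l \<in> L" "s / e \<le> \<bar>X l x\<bar>" by (auto simp: not_less)
      then have "s / e * e \<le> \<bar>X l x\<bar> * \<bar>Y b x\<bar>"
        using e \<open>e \<le> \<bar>Y b x\<bar>\<close> by (intro mult_mono) auto
      then have "s \<le> \<bar>X l x * Y b x\<bar>" using e by (simp add: abs_mult)
      moreover have "l \<noteq> b" using l L by auto
      ultimately show "x \<in> exceed (insert b L) s"
        using l \<open>x \<in> space M\<close> by (auto simp: exceed_def)
    qed
  qed
  also have "\<dots> = exceed_prob (Suc n) s"
    using L assms by (subst prob_exceed) (auto simp: card_insert_if)
  finally show ?thesis by (simp add: E_def p_def)
qed

text \<open>Exchanging the components amounts to exchanging the two indices \<open>a\<close> and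
  \<open>b\<close>.\<close>

lemma exceed_prob_swap: "iid_pairs.exceed_prob M Y X I = exceed_prob"
proof -
  have "(\<exists>a\<in>J. \<exists>b\<in>J. a \<noteq> b \<and> t \<le> \<bar>Y a x * X b x\<bar>)
      \<longleftrightarrow> (\<exists>a\<in>J. \<exists>b\<in>J. a \<noteq> b \<and> t \<le> \<bar>X a x * Y b x\<bar>)" for J t x
    by (metis mult.commute)
  then have "iid_pairs.exceed M Y X J t = exceed J t" for J t
    by (simp only: iid_pairs.exceed_def[OF iid_pairs_swap] exceed_def)
  then show ?thesis
    by (intro ext) (simp add: iid_pairs.exceed_prob_def[OF iid_pairs_swap] exceed_prob_def)
qed

text \<open>As |Y b| \<ge> e has positive probability \<delta> for some e,
  \<open>exceed_prob_lower_bound\<close> turns the hypothesis into summability of n P(e |X a| \<ge>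
  n^\<alpha>), that is, a second moment of |X a|^(1 / \<alpha>).\<close>

lemma integrable_powr_X:
  assumes summ: "summable (\<lambda>n. exceed_prob (Suc n) (real (Suc n) powr \<alpha>))" and \<alpha>: "0 < \<alpha>"
    and a: "a \<in> I" and b: "b \<in> I" and nondeg: "\<not> (AE x in M. Y b x = 0)"
    and r: "0 \<le> r" "r \<le> 2 / \<alpha>"
  shows "integrable M (\<lambda>x. \<bar>X a x\<bar> powr r)"
proof -
  note [measurable] = rv_X[OF a] rv_Y[OF b]
  \<comment> \<open>Otherwise |Y b| < 1 / (n + 1) almost surely for every n, so \<open>Y b\<close>
    vanishes almost surely.\<close>
  obtain e where e: "0 < e" and \<delta>: "0 < prob {x \<in> space M. e \<le> \<bar>Y b x\<bar>}"
  proof (rule ccontr)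
    assume "\<not> thesis"
    with that have "prob {x \<in> space M. 1 / real (Suc n) \<le> \<bar>Y b x\<bar>} = 0" for n
      by (metis measure_nonneg of_nat_0_less_iff zero_less_Suc zero_less_divide_1_iff less_eq_real_def)
    then have "AE x in M. \<not> 1 / real (Suc n) \<le> \<bar>Y b x\<bar>" for n
      by (subst AE_iff_measurable[OF _ refl]) (simp_all add: emeasure_eq_measure del: not_le)
    then have "AE x in M. \<forall>n. \<not> 1 / real (Suc n) \<le> \<bar>Y b x\<bar>"
      by (subst AE_all_countable) blast
    then have "AE x in M. Y b x = 0"
    proof eventually_elim
      case (elim x)
      show ?case
      proof (rule ccontr)
        assume "Y b x \<noteq> 0"
        then obtain n where "inverse (real (Suc n)) < \<bar>Y b x\<bar>"
          using reals_Archimedean[of "\<bar>Y b x\<bar>"] by auto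
        then show False using elim[rule_format, of n] by (simp add: inverse_eq_divide)
      qed
    qed
    with nondeg show False by simp
  qed
  define \<delta> where "\<delta> = prob {x \<in> space M. e \<le> \<bar>Y b x\<bar>}"
  \<comment> \<open>For n \<ge> 1 the event in \<open>p n\<close> is Z \<ge> n, and the square of
    \<open>Z\<close> is a multiple of |X a|^(2 / \<alpha>).\<close>
  define Z where "Z x = (e * \<bar>X a x\<bar>) powr (1 / \<alpha>)" for x
  define p where "p n = prob {x \<in> space M. real n powr \<alpha> / e \<le> \<bar>X a x\<bar>}" for n
  define s where "s n = exceed_prob (Suc n) (real (Suc n) powr \<alpha>)" for n
  have \<delta>_pos: "0 < \<delta>" using \<delta> by (simp add: \<delta>_def)
  have p01: "0 \<le> p n" "p n \<le> 1" for n by (auto simp: p_def)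
  have "s \<longlonglongrightarrow> 0"
    using summ unfolding s_def by (rule summable_LIMSEQ_zero)
  then have "eventually (\<lambda>n. s n < \<delta> / 2) sequentially"
    using \<delta>_pos by (intro order_tendstoD) auto
  then have ev: "eventually (\<lambda>n. norm (real n * p (Suc n)) \<le> 2 / \<delta> * s n) sequentially"
  proof eventually_elim
    case (elim n)
    define u where "u = real n * p (Suc n)"
    have u: "0 \<le> u" using p01 by (simp add: u_def)
    have "(1 - p (Suc n)) ^ n \<le> exp (- p (Suc n)) ^ n"
      using p01[of "Suc n"] exp_ge_add_one_self[of "- p (Suc n)"] by (intro power_mono) auto
    also have "\<dots> = 1 / exp u"
      by (simp add: u_def exp_of_nat_mult[symmetric] exp_minus field_simps)
    also have "\<dots> \<le> 1 / (1 + u)"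
      using u exp_ge_add_one_self[of u] by (intro divide_left_mono) auto
    finally have "u / (1 + u) \<le> 1 - (1 - p (Suc n)) ^ n"
      using u by (simp add: field_simps)
    then have "\<delta> * (u / (1 + u)) \<le> \<delta> * (1 - (1 - p (Suc n)) ^ n)"
      using \<delta>_pos by (intro mult_left_mono) auto
    also have "\<dots> \<le> s n"
      using exceed_prob_lower_bound[OF a b e] unfolding \<delta>_def p_def s_def .
    \<comment> \<open>A bootstrap: s n < \<delta> / 2 first yields u \<le> 1, and then the factor 1
      + u is at most 2, which leaves u \<le> 2 s n / \<delta>.\<close>
    finally have *: "\<delta> * u \<le> s n * (1 + u)"
      using u by (simp add: field_simps)
    also have "\<dots> \<le> \<delta> / 2 * (1 + u)"
      using elim u by (intro mult_right_mono) auto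
    finally have "\<delta> * u \<le> \<delta> * 1" by (simp add: field_simps)
    then have "u \<le> 1" using \<delta>_pos by simp
    then have "s n * (1 + u) \<le> s n * 2"
      using exceed_prob_nonneg by (intro mult_left_mono) (auto simp: s_def)
    with * have "\<delta> * u \<le> s n * 2" by linarith
    then show ?case
      using \<delta>_pos u by (simp add: u_def[symmetric] field_simps)
  qed
  have "summable (\<lambda>n. real n * p (Suc n))"
    using summ by (intro summable_comparison_test_ev[OF ev] summable_mult) (simp add: s_def)
  then have sum2: "summable (\<lambda>n. 2 * (real n * p (Suc n)))"
    by (rule summable_mult)
  \<comment> \<open>The lower bound sets one index aside for \<open>Y b\<close> and so gives weight
    \<open>n\<close>; the weight \<open>Suc n\<close> is at most twice as large once n \<ge>
    1.\<close>
  have "summable (\<lambda>n. real (Suc n) * p (Suc n))"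
  proof (rule summable_comparison_test_ev[OF _ sum2])
    show "eventually (\<lambda>n. norm (real (Suc n) * p (Suc n)) \<le> 2 * (real n * p (Suc n))) sequentially"
      using eventually_ge_at_top[of 1]
    proof eventually_elim
      case (elim n)
      have "real (Suc n) * p (Suc n) \<le> (2 * real n) * p (Suc n)"
        using elim p01 by (intro mult_right_mono) auto
      then show ?case using p01 by simp
    qed
  qed
  then have "summable (\<lambda>n. real n * p n)"
    by (subst (asm) summable_Suc_iff)
  moreover have "real n * p n = real n * prob {x \<in> space M. real n \<le> Z x}" for n
  proof (cases "n = 0")
    case False
    have "real n powr \<alpha> / e \<le> \<bar>X a x\<bar> \<longleftrightarrow> real n \<le> Z x" for x
    proof -
      have "real n powr \<alpha> / e \<le> \<bar>X a x\<bar> \<longleftrightarrow> real n powr \<alpha> \<le> e * \<bar>X a x\<bar>"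
        using e by (simp add: field_simps)
      also have "\<dots> \<longleftrightarrow> real n powr \<alpha> \<le> Z x powr \<alpha>"
        using e \<alpha> by (simp add: Z_def powr_powr)
      also have "\<dots> \<longleftrightarrow> real n \<le> Z x"
        using \<alpha> powr_mono2[of \<alpha> "real n" "Z x"] powr_less_mono2[of \<alpha> "Z x" "real n"]
        by (force simp: Z_def)
      finally show ?thesis .
    qed
    then show ?thesis by (simp add: p_def)
  qed simp
  moreover have dbl: "y powr (2 / \<alpha>) = (y powr (1 / \<alpha>))\<^sup>2" for y
    by (simp add: power2_eq_square flip: powr_add)
  ultimately have "integrable M (\<lambda>x. (Z x)\<^sup>2)"
    by (intro integrable_square_of_tail_sum) (auto simp: Z_def)
  also have "(\<lambda>x. (Z x)\<^sup>2) = (\<lambda>x. e powr (2 / \<alpha>) * \<bar>X a x\<bar> powr (2 / \<alpha>))"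
    using e by (simp add: Z_def fun_eq_iff powr_mult power_mult_distrib dbl)
  finally have full: "integrable M (\<lambda>x. \<bar>X a x\<bar> powr (2 / \<alpha>))"
    using e by simp
  show ?thesis
  proof (rule Bochner_Integration.integrable_bound)
    show "integrable M (\<lambda>x. 1 + \<bar>X a x\<bar> powr (2 / \<alpha>))"
      using full by simp
    have "y powr r \<le> 1 + y powr (2 / \<alpha>)" if "0 \<le> y" for y
    proof (cases "y \<le> 1")
      case True
      then have "y powr r \<le> 1" using that r powr_mono2[of r y 1] by simp
      then show ?thesis by (simp add: add_increasing2)
    next
      case False
      then have "y powr r \<le> y powr (2 / \<alpha>)" using r by (intro powr_mono) auto
      then show ?thesis by simp
    qed
    then show "AE x in M. norm (\<bar>X a x\<bar> powr r) \<le> norm (1 + \<bar>X a x\<bar> powr (2 / \<alpha>))"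
      by (simp add: add_nonneg_nonneg)
  qed simp
qed

text \<open>The moment of one component needs the other to be nondegenerate. If one vanishes almost
  surely, the hypothesis carries no information on the other.\<close>

lemma degenerate_or_integrable:
  assumes summ: "summable (\<lambda>n. exceed_prob (Suc n) (real (Suc n) powr \<alpha>))" and \<alpha>: "0 < \<alpha>"
    and ab: "a \<in> I" "b \<in> I"
    and r: "0 \<le> r" "r \<le> 2 / \<alpha>"
  obtains "AE x in M. X a x = 0" | "AE x in M. Y b x = 0"
  | "integrable M (\<lambda>x. \<bar>X a x\<bar> powr r)" "integrable M (\<lambda>x. \<bar>Y b x\<bar> powr r)"
  using integrable_powr_X[OF summ \<alpha> ab _ r]
    iid_pairs.integrable_powr_X[OF iid_pairs_swap, unfolded exceed_prob_swap, OF summ \<alpha> ab(2,1) _ r]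
  by blast

text \<open>Either the product vanishes almost surely, or independence multiplies the two
  moments.\<close>

lemma integrable_powr_XY:
  assumes summ: "summable (\<lambda>n. exceed_prob (Suc n) (real (Suc n) powr \<alpha>))" and \<alpha>: "0 < \<alpha>"
    and ab: "a \<in> I" "b \<in> I" "a \<noteq> b"
    and r: "0 \<le> r" "r \<le> 2 / \<alpha>"
  shows "integrable M (\<lambda>x. \<bar>X a x * Y b x\<bar> powr r)"
proof (rule degenerate_or_integrable[OF summ \<alpha> ab(1,2) r])
  note [measurable] = rv_X[OF ab(1)] rv_Y[OF ab(2)]
  have zero: "integrable M (\<lambda>x. \<bar>X a x * Y b x\<bar> powr r)" if "AE x in M. X a x * Y b x = 0"
  proof -
    have "AE x in M. \<bar>X a x * Y b x\<bar> powr r = 0"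
      using that by eventually_elim simp
    then have "integrable M (\<lambda>x. \<bar>X a x * Y b x\<bar> powr r) \<longleftrightarrow> integrable M (\<lambda>x. 0 :: real)"
      by (intro integrable_cong_AE) auto
    then show ?thesis by simp
  qed
  show ?thesis if "AE x in M. X a x = 0"
    by (rule zero) (use that in eventually_elim, simp)
  show ?thesis if "AE x in M. Y b x = 0"
    by (rule zero) (use that in eventually_elim, simp)
  assume int: "integrable M (\<lambda>x. \<bar>X a x\<bar> powr r)" "integrable M (\<lambda>x. \<bar>Y b x\<bar> powr r)"
  have "indep_var borel ((\<lambda>u. \<bar>u\<bar> powr r) \<circ> X a) borel ((\<lambda>u. \<bar>u\<bar> powr r) \<circ> Y b)"
    by (rule indep_var_compose[OF indep_var_XY[OF ab]]) auto
  from indep_var_integrable[OF this] int show ?thesis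
    by (simp add: comp_def abs_mult powr_mult)
qed

text \<open>In the degenerate cases the other factor may fail to be integrable, but its expectation
  is still a real number (0 by default), so both sides are 0.\<close>

lemma expectation_XY:
  assumes summ: "summable (\<lambda>n. exceed_prob (Suc n) (real (Suc n) powr \<alpha>))" and \<alpha>: "0 < \<alpha>" "\<alpha> \<le> 1"
    and ab: "a \<in> I" "b \<in> I" "a \<noteq> b"
  shows "expectation (\<lambda>x. X a x * Y b x) = expectation (X a) * expectation (Y b)"
proof -
  note [measurable] = rv_X[OF ab(1)] rv_Y[OF ab(2)]
  have "0 \<le> (1 :: real)" "1 \<le> 2 / \<alpha>" using \<alpha> by (auto simp: field_simps)
  from degenerate_or_integrable[OF summ \<alpha>(1) ab(1,2) this]
  consider "AE x in M. X a x = 0" | "AE x in M. Y b x = 0" | "integrable M (X a)" "integrable M (Y b)"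
    by (auto simp: integrable_abs_iff)
  then show ?thesis
  proof cases
    case 1
    then have "expectation (X a) = 0" "expectation (\<lambda>x. X a x * Y b x) = 0"
      by (auto intro!: integral_eq_zero_AE elim: eventually_mono)
    then show ?thesis by simp
  next
    case 2
    then have "expectation (Y b) = 0" "expectation (\<lambda>x. X a x * Y b x) = 0"
      by (auto intro!: integral_eq_zero_AE elim: eventually_mono)
    then show ?thesis by simp
  next
    case 3
    then show ?thesis by (rule indep_var_lebesgue_integral[OF indep_var_XY[OF ab]])
  qed
qed

lemma expectation_fun_XY_eq:
  fixes f :: "real \<Rightarrow> real"
  assumes [measurable]: "f \<in> borel_measurable borel"
    and "a \<in> I" "b \<in> I" "a \<noteq> b" "a' \<in> I" "b' \<in> I" "a' \<noteq> b'"
  shows "expectation (\<lambda>x. f (X a x * Y b x)) = expectation (\<lambda>x. f (X a' x * Y b' x))"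
proof -
  have "expectation (\<lambda>x. f (X a x * Y b x)) = integral\<^sup>L (distr M borel (\<lambda>x. X a x * Y b x)) f"
    if "a \<in> I" "b \<in> I" for a b
    using that by (subst integral_distr) auto
  then show ?thesis using distr_XY[OF assms(2-)] assms by simp
qed

lemma expectation_X_eq: "expectation (X a) = expectation (X b)" if "a \<in> I" "b \<in> I"
proof -
  have "expectation (X a) = integral\<^sup>L (distr M borel (X a)) (\<lambda>u. u)" if "a \<in> I" for a
    using that by (subst integral_distr) auto
  then show ?thesis using distr_X[OF that] that by simp
qed

end

section \<open>Arrays of independent identically distributed pairs\<close>

text \<open>A constant, because the simplifier would rewrite \<open>1\<close> to \<open>Suc 0\<close> inside \<open>{1..}\<close> and then the
  facts inherited from \<open>iid_pairs\<close> would no longer match.\<close>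
definition array_index :: "(nat \<times> nat) set" where
  "array_index = {1..} \<times> {1..}"

lemma mem_array_index [simp]: "(k, i) \<in> array_index \<longleftrightarrow> 1 \<le> k \<and> 1 \<le> i"
  by (simp add: array_index_def)

locale iid_array = prob_space M for M :: "'s measure" +
  fixes U V :: "nat \<Rightarrow> nat \<Rightarrow> 's \<Rightarrow> real"
  assumes indep_array: "indep_vars (\<lambda>_. borel) (\<lambda>(k, i) x. (U k i x, V k i x)) ({1..} \<times> {1..})"
    and ident_array: "\<And>k i. k \<ge> 1 \<Longrightarrow> i \<ge> 1 \<Longrightarrow>
      distr M borel (\<lambda>x. (U k i x, V k i x)) = distr M borel (\<lambda>x. (U 1 1 x, V 1 1 x))"
begin

sublocale iid_pairs M "\<lambda>(k, i). U k i" "\<lambda>(k, i). V k i" array_index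
proof
  show "infinite array_index"
    by (simp add: array_index_def finite_cartesian_product_iff infinite_Ici)
  have eq: "(\<lambda>a x. ((case a of (k, i) \<Rightarrow> U k i) x, (case a of (k, i) \<Rightarrow> V k i) x))
      = (\<lambda>(k, i) x. (U k i x, V k i x))"
    by (auto simp: fun_eq_iff)
  show "indep_vars (\<lambda>_. borel) (\<lambda>a x. ((case a of (k, i) \<Rightarrow> U k i) x, (case a of (k, i) \<Rightarrow> V k i) x))
      array_index"
    unfolding eq array_index_def by (rule indep_array)
  show "distr M borel (\<lambda>x. ((case a of (k, i) \<Rightarrow> U k i) x, (case a of (k, i) \<Rightarrow> V k i) x))
      = distr M borel (\<lambda>x. ((case b of (k, i) \<Rightarrow> U k i) x, (case b of (k, i) \<Rightarrow> V k i) x))"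
    if "a \<in> array_index" "b \<in> array_index" for a b
    using that ident_array[of "fst a" "snd a"] ident_array[of "fst b" "snd b"]
    by (simp add: case_prod_beta mem_Times_iff array_index_def)
qed

lemma rv_U [measurable]: "k \<ge> 1 \<Longrightarrow> i \<ge> 1 \<Longrightarrow> random_variable borel (U k i)"
  using rv_X[of "(k, i)"] by simp

lemma rv_V [measurable]: "k \<ge> 1 \<Longrightarrow> i \<ge> 1 \<Longrightarrow> random_variable borel (V k i)"
  using rv_Y[of "(k, i)"] by simp

lemma exceed_row:
  "exceed ({k} \<times> {1..m}) t
    = {x \<in> space M. \<exists>i\<in>{1..m}. \<exists>j\<in>{1..m}. i \<noteq> j \<and> t \<le> \<bar>U k i x * V k j x\<bar>}"
  by (simp add: exceed_def)

lemma prob_exceed_row: "k \<ge> 1 \<Longrightarrow> prob (exceed ({k} \<times> {1..m}) t) = exceed_prob m t"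
  by (subst prob_exceed) auto

lemma events_exceed_row: "k \<ge> 1 \<Longrightarrow> exceed ({k} \<times> {1..m}) t \<in> events"
  by (rule exceed_events) auto

text \<open>The k-th product uses only the entries at (k, i) and (k, j), and these index sets are
  disjoint for different k.\<close>

lemma indep_products:
  assumes "i \<ge> 1" "j \<ge> 1"
  shows "indep_vars (\<lambda>_. borel) (\<lambda>k x. U k i x * V k j x) {1..}"
proof -
  let ?N = "\<lambda>k. PiM {(k, i), (k, j)} (\<lambda>_. borel :: (real \<times> real) measure)"
  have "indep_vars ?N (\<lambda>k x. \<lambda>a\<in>{(k, i), (k, j)}.
      ((case a of (k, i) \<Rightarrow> U k i) x, (case a of (k, i) \<Rightarrow> V k i) x)) {1..}"
    using assms by (intro indep_vars_restrict[OF indep]) (auto simp: disjoint_family_on_def)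
  moreover have "(\<lambda>w. fst (w (k, i)) * snd (w (k, j))) \<in> ?N k \<rightarrow>\<^sub>M borel" for k
  proof -
    have "(\<lambda>w. fst (w (k, i))) \<in> ?N k \<rightarrow>\<^sub>M borel" "(\<lambda>w. snd (w (k, j))) \<in> ?N k \<rightarrow>\<^sub>M borel"
      using measurable_compose[OF measurable_component_singleton[of "(k, i)" "{(k, i), (k, j)}" "\<lambda>_. borel"] borel_measurable_fst]
        measurable_compose[OF measurable_component_singleton[of "(k, j)" "{(k, i), (k, j)}" "\<lambda>_. borel"] borel_measurable_snd]
      by auto
    then show ?thesis by simp
  qed
  ultimately show ?thesis
    using indep_vars_compose2[of ?N _ "{1..}" "\<lambda>k w. fst (w (k, i)) * snd (w (k, j))" "\<lambda>_. borel"]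
    by fastforce
qed

section \<open>Sufficiency of the conditions\<close>

text \<open>The event \<open>A m\<close> serves all n from 2^m up to 2^(m+1) at once, by taking the
  most rows and columns and the smallest threshold. Its probability is compared with a dyadic block
  of the hypothesis, and the first Borel-Cantelli lemma applies.\<close>

lemma eventually_entries_small:
  assumes summ: "summable (\<lambda>n. exceed_prob (Suc n) (real (Suc n) powr \<alpha>))" and \<alpha>: "0 < \<alpha>" and \<eta>: "0 < \<eta>"
  shows "AE x in M. eventually (\<lambda>n. \<forall>k\<in>{1..n}. \<forall>i\<in>{1..K * n}. \<forall>j\<in>{1..K * n}. i \<noteq> j \<longrightarrow>
    \<bar>U k i x * V k j x\<bar> < \<eta> * real n powr \<alpha>) sequentially"
proof -
  define a where "a n = exceed_prob n (real n powr \<alpha>)" for n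
  define A where "A m = (\<Union>k\<in>{1..2 ^ Suc m}. exceed ({k} \<times> {1..K * 2 ^ Suc m}) (\<eta> * (2 ^ m) powr \<alpha>))" for m
  have "summable a"
    using summ unfolding a_def by (subst (asm) summable_Suc_iff)
  then have d: "summable (\<lambda>l. \<Sum>n\<in>{2 ^ l<..2 ^ Suc l}. a n)"
    by (rule summable_dyadic_blocks) (simp add: a_def exceed_prob_nonneg)
  \<comment> \<open>Comparing \<open>A (l + Suc s)\<close> with block \<open>l\<close> absorbs
    \<eta>: the threshold \<eta> 2^(m \<alpha>) at m = l + s + 1 is then at least n^\<alpha> for
    every n in the block.\<close>
  obtain s where s: "(1 / 2 ^ s) powr \<alpha> \<le> \<eta>"
  proof -
    have "(\<lambda>s. (1 / 2 ^ s :: real) powr \<alpha>) \<longlonglongrightarrow> 0"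
      using \<alpha> by real_asymp
    then have "eventually (\<lambda>s. (1 / 2 ^ s :: real) powr \<alpha> < \<eta>) sequentially"
      using \<eta> by (intro order_tendstoD) auto
    then show ?thesis
      using that by (auto simp: eventually_sequentially intro: less_imp_le)
  qed
  define c where "c = K * 2 ^ (s + 2)"
  have A_events: "A m \<in> events" for m
    unfolding A_def by (intro sets.finite_UN events_exceed_row) auto
  have prob_A: "prob (A (l + Suc s))
      \<le> (2 ^ (s + 2) * (3 * real c)\<^sup>2) * (\<Sum>n\<in>{2 ^ l<..2 ^ Suc l}. a n)" for l
  proof -
    let ?m = "l + Suc s"
    let ?Q = "exceed_prob (K * 2 ^ Suc ?m) (\<eta> * (2 ^ ?m) powr \<alpha>)"
    have "prob (A ?m) \<le> (\<Sum>k\<in>{1..2 ^ Suc ?m}. prob (exceed ({k} \<times> {1..K * 2 ^ Suc ?m}) (\<eta> * (2 ^ ?m) powr \<alpha>)))"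
      unfolding A_def
      by (intro finite_measure_subadditive_finite image_subsetI events_exceed_row; simp)
    also have "\<dots> = (\<Sum>k\<in>{1..2 ^ Suc ?m :: nat}. ?Q)"
      by (intro sum.cong prob_exceed_row) auto
    also have "\<dots> = 2 ^ (s + 2) * (2 ^ l * ?Q)"
      by (simp add: power_add)
    \<comment> \<open>The block has exactly 2^l elements, so each of the 2^l copies is charged to
      one term of the hypothesis.\<close>
    also have "2 ^ l * ?Q = (\<Sum>n\<in>{2 ^ l<..2 ^ Suc l :: nat}. ?Q)"
      by simp
    also have "\<dots> \<le> (\<Sum>n\<in>{2 ^ l<..2 ^ Suc l}. (3 * real c)\<^sup>2 * a n)"
    proof (rule sum_mono)
      fix n :: nat assume n: "n \<in> {2 ^ l<..2 ^ Suc l}"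
      have "2 \<le> n" using n one_le_power[of "2 :: nat" l] by auto
      moreover have "K * 2 ^ Suc ?m = K * 2 ^ (s + 2) * 2 ^ l"
        by (simp add: power_add)
      then have "K * 2 ^ Suc ?m \<le> c * n"
        unfolding c_def using n by (simp only:) (intro mult_le_mono2, auto)
      ultimately have "?Q \<le> (3 * real c)\<^sup>2 * exceed_prob n (\<eta> * (2 ^ ?m) powr \<alpha>)"
        by (rule exceed_prob_scale)
      also have "exceed_prob n (\<eta> * (2 ^ ?m) powr \<alpha>) \<le> a n"
        unfolding a_def
      proof (rule exceed_prob_mono[OF order_refl])
        have "real n \<le> real (2 ^ Suc l)"
          using n by (simp only: of_nat_le_iff) simp
        then have "real n powr \<alpha> \<le> (2 ^ Suc l) powr \<alpha>"
          using \<alpha> by (intro powr_mono2) simp_all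
        also have "(2 ^ Suc l :: real) = 1 / 2 ^ s * 2 ^ ?m"
          by (simp add: power_add)
        also have "\<dots> powr \<alpha> = (1 / 2 ^ s) powr \<alpha> * (2 ^ ?m) powr \<alpha>"
          by (rule powr_mult)
        also have "\<dots> \<le> \<eta> * (2 ^ ?m) powr \<alpha>"
          using s by (intro mult_right_mono) auto
        finally show "real n powr \<alpha> \<le> \<eta> * (2 ^ ?m) powr \<alpha>" .
      qed
      finally show "?Q \<le> (3 * real c)\<^sup>2 * a n" by (simp add: mult_left_mono)
    qed
    finally show ?thesis
      by (simp add: sum_distrib_left mult_ac)
  qed
  have "summable (\<lambda>l. prob (A (l + Suc s)))"
    by (rule summable_comparison_test'[OF summable_mult[OF d], where N=0]) (use prob_A in auto)
  then have "summable (\<lambda>m. prob (A m))"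
    by (subst (asm) summable_iff_shift)
  then have "AE x in M. eventually (\<lambda>m. x \<in> space M - A m) sequentially"
    by (intro borel_cantelli_AE1 A_events) (auto simp: emeasure_eq_measure)
  then show ?thesis
  proof eventually_elim
    case (elim x)
    then obtain N where N: "\<And>m. m \<ge> N \<Longrightarrow> x \<in> space M - A m"
      by (auto simp: eventually_sequentially)
    show ?case
      using eventually_ge_at_top[of "2 ^ N"]
    proof eventually_elim
      case (elim n)
      obtain m where m: "2 ^ m \<le> n" "n < 2 ^ Suc m"
        using ex_power_ivl1[of 2 n] le_trans[OF one_le_power[of 2 N] elim] by auto
      have "(2 :: nat) ^ N < 2 ^ Suc m" using elim m by linarith
      then have "N \<le> m" by (simp only: power_strict_increasing_iff)
      then have x: "x \<in> space M" "x \<notin> A m" using N by auto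
      show ?case
      proof (intro ballI impI)
        fix k i j assume *: "k \<in> {1..n}" "i \<in> {1..K * n}" "j \<in> {1..K * n}" "i \<noteq> j"
        have le: "K * n \<le> K * 2 ^ Suc m" using m by (intro mult_le_mono2) auto
        have "k \<in> {1..2 ^ Suc m}" using * m by auto
        then have "x \<notin> exceed ({k} \<times> {1..K * 2 ^ Suc m}) (\<eta> * (2 ^ m) powr \<alpha>)"
          using x unfolding A_def by blast
        moreover have "i \<in> {1..K * 2 ^ Suc m}" "j \<in> {1..K * 2 ^ Suc m}"
          using *(2,3) le_trans[OF _ le, of i] le_trans[OF _ le, of j]
          unfolding atLeastAtMost_iff by blast+
        ultimately have "\<bar>U k i x * V k j x\<bar> < \<eta> * (2 ^ m) powr \<alpha>"
          using x * unfolding exceed_row by (metis (mono_tags, lifting) mem_Collect_eq not_le)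
        also have "(2 ^ m) powr \<alpha> \<le> real n powr \<alpha>"
        proof (rule powr_mono2)
          have "real (2 ^ m) \<le> real n" using m by (simp only: of_nat_le_iff)
          then show "2 ^ m \<le> real n" by simp
        qed (use \<alpha> in auto)
        finally show "\<bar>U k i x * V k j x\<bar> < \<eta> * real n powr \<alpha>"
          using \<eta> by simp
      qed
    qed
  qed
qed

text \<open>The exponent in \<open>truncated_sum_tail\<close> is at most 1 - 4 ln n, so each pair
  contributes at most 2 e / n^4. A union over at most K^2 n^2 pairs leaves a summable bound of order
  n^(-2).\<close>

lemma eventually_truncated_sums_small:
  assumes r: "r \<le> 2" "1 < \<alpha> * r" and \<epsilon>: "0 < \<epsilon>"
    and int: "\<And>k i j. k \<ge> 1 \<Longrightarrow> i \<ge> 1 \<Longrightarrow> j \<ge> 1 \<Longrightarrow> i \<noteq> j \<Longrightarrow>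
      integrable M (\<lambda>x. \<bar>U k i x * V k j x\<bar> powr r)"
    and centred: "r \<le> 1 \<or> 1 \<le> r \<and> (\<forall>k i j. k \<ge> 1 \<longrightarrow> i \<ge> 1 \<longrightarrow> j \<ge> 1 \<longrightarrow> i \<noteq> j \<longrightarrow>
      integrable M (\<lambda>x. U k i x * V k j x) \<and> expectation (\<lambda>x. U k i x * V k j x) = 0)"
  obtains \<eta> where "0 < \<eta>"
    "AE x in M. eventually (\<lambda>n. \<forall>i\<in>{1..K * n}. \<forall>j\<in>{1..K * n}. i \<noteq> j \<longrightarrow>
      \<bar>\<Sum>k=1..n. if \<bar>U k i x * V k j x\<bar> \<le> \<eta> * real n powr \<alpha> then U k i x * V k j x else 0\<bar>
        < \<epsilon> * real n powr \<alpha>) sequentially"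
proof -
  define L where "L = 4 / \<epsilon>"
  define \<eta> where "\<eta> = (\<alpha> * r - 1) / (2 * L)"
  define \<mu> where "\<mu> = expectation (\<lambda>x. \<bar>U 1 1 x * V 1 2 x\<bar> powr r)"
  have L: "0 < L" using \<epsilon> by (simp add: L_def)
  have \<eta>: "0 < \<eta>" "L * \<eta> = (\<alpha> * r - 1) / 2" using r L by (auto simp: \<eta>_def)
  define S where "S n i j x = (\<Sum>k=1..n. if \<bar>U k i x * V k j x\<bar> \<le> \<eta> * real n powr \<alpha>
    then U k i x * V k j x else 0)" for n i j x
  define P where "P n = {1..K * n} \<times> {1..K * n} - Id" for n
  define B where "B n = (\<Union>p\<in>P n. {x \<in> space M. \<epsilon> * real n powr \<alpha> \<le> \<bar>S n (fst p) (snd p) x\<bar>})" for n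
  have S_meas: "random_variable borel (S n i j)" if "i \<ge> 1" "j \<ge> 1" for n i j
    unfolding S_def using that by (intro borel_measurable_sum) auto
  have ev_events: "{x \<in> space M. \<epsilon> * real n powr \<alpha> \<le> \<bar>S n (fst p) (snd p) x\<bar>} \<in> events"
    if "p \<in> P n" for n p
    using that S_meas[of "fst p" "snd p" n] by (intro borel_measurable_le) (auto simp: P_def)
  have P_fin: "finite (P n)" for n by (simp add: P_def)
  have B_events: "B n \<in> events" for n
    unfolding B_def by (intro sets.finite_UN P_fin ev_events)
  have "eventually (\<lambda>n. norm (prob (B n)) \<le> (2 * exp 1 * (real K)\<^sup>2) * (1 / real n ^ 2)) sequentially"
    using truncation_exponent_eventually[OF r(2) L \<eta>, of \<mu>] eventually_gt_at_top[of 0]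
  proof eventually_elim
    case (elim n)
    define t b where "t = L * ln (real n) / real n powr \<alpha>" and "b = \<eta> * real n powr \<alpha>"
    have t: "0 \<le> t" using elim L by (simp add: t_def)
    have b: "0 < b" using elim \<eta> by (simp add: b_def)
    have ts: "t * (\<epsilon> * real n powr \<alpha>) = 4 * ln (real n)"
      using elim \<epsilon> by (simp add: t_def L_def)
    have bound: "prob {x \<in> space M. \<epsilon> * real n powr \<alpha> \<le> \<bar>S n (fst p) (snd p) x\<bar>}
        \<le> 2 * exp 1 / real n ^ 4" if p_in: "p \<in> P n" for p
    proof -
      obtain i j where p: "p = (i, j)" and ij: "i \<ge> 1" "j \<ge> 1" "i \<noteq> j"
        using p_in by (cases p) (auto simp: P_def)
      have \<mu>: "expectation (\<lambda>x. \<bar>U k i x * V k j x\<bar> powr r) = \<mu>" if "k \<ge> 1" for k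
        using expectation_fun_XY_eq[of "\<lambda>z. \<bar>z\<bar> powr r" "(k, i)" "(k, j)" "(1, 1)" "(1, 2)"] ij that
        by (simp add: \<mu>_def)
      have "prob {x \<in> space M. \<epsilon> * real n powr \<alpha> \<le> \<bar>S n i j x\<bar>}
          \<le> 2 * exp (real (card {1..n}) * (t * b powr (1 - r) * \<mu> + t\<^sup>2 * b powr (2 - r) * \<mu> * exp (t * b))
            - t * (\<epsilon> * real n powr \<alpha>))"
        unfolding S_def b_def[symmetric]
        by (rule truncated_sum_tail[OF _ indep_vars_subset[OF indep_products[OF ij(1,2)]] r(1)])
           (use ij int \<mu> centred t b in auto)
      also have "\<dots> \<le> 2 * exp (1 - 4 * ln (real n))"
        using elim unfolding ts Let_def t_def[symmetric] b_def[symmetric] by simp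
      also have "\<dots> = 2 * exp 1 / real n ^ 4"
        using elim(2) exp_of_nat_mult[of 4 "ln (real n)"] by (simp add: exp_diff)
      finally show ?thesis by (simp add: p)
    qed
    have "prob (B n) \<le> (\<Sum>p\<in>P n. prob {x \<in> space M. \<epsilon> * real n powr \<alpha> \<le> \<bar>S n (fst p) (snd p) x\<bar>})"
      unfolding B_def by (intro finite_measure_subadditive_finite P_fin image_subsetI ev_events)
    also have "\<dots> \<le> real (card (P n)) * (2 * exp 1 / real n ^ 4)"
      by (intro sum_bounded_above bound)
    also have "\<dots> \<le> real (K * n * (K * n)) * (2 * exp 1 / real n ^ 4)"
    proof (intro mult_right_mono, subst of_nat_le_iff)
      have "card (P n) \<le> card ({1..K * n} \<times> {1..K * n})"
        unfolding P_def by (intro card_mono) auto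
      then show "card (P n) \<le> K * n * (K * n)" by simp
    qed simp
    also have "\<dots> = (2 * exp 1 * (real K)\<^sup>2) * (1 / real n ^ 2)"
      using elim(2) by (simp add: field_simps power2_eq_square power4_eq_xxxx)
    finally show ?case by simp
  qed
  then have "summable (\<lambda>n. prob (B n))"
    by (rule summable_comparison_test_ev)
       (intro summable_mult, use inverse_power_summable[of 2, where 'a=real] in \<open>simp add: inverse_eq_divide\<close>)
  then have "AE x in M. eventually (\<lambda>n. x \<in> space M - B n) sequentially"
    by (intro borel_cantelli_AE1 B_events) (auto simp: emeasure_eq_measure)
  then have "AE x in M. eventually (\<lambda>n. \<forall>i\<in>{1..K * n}. \<forall>j\<in>{1..K * n}. i \<noteq> j \<longrightarrow>
      \<bar>S n i j x\<bar> < \<epsilon> * real n powr \<alpha>) sequentially"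
  proof eventually_elim
    case (elim x)
    then show ?case
    proof eventually_elim
      case (elim n)
      show ?case
      proof (intro ballI impI)
        fix i j assume "i \<in> {1..K * n}" "j \<in> {1..K * n}" "i \<noteq> j"
        then have "(i, j) \<in> P n" by (simp add: P_def)
        then show "\<bar>S n i j x\<bar> < \<epsilon> * real n powr \<alpha>"
          using elim unfolding B_def by force
      qed
    qed
  qed
  then show ?thesis
    using that[OF \<eta>(1)] unfolding S_def by blast
qed

text \<open>For the \<eta> supplied by the truncated estimate,
  \<open>eventually_entries_small\<close> makes the truncation inactive from some n on.\<close>

lemma eventually_sums_small:
  assumes summ: "summable (\<lambda>n. exceed_prob (Suc n) (real (Suc n) powr \<alpha>))" and \<alpha>: "1 / 2 < \<alpha>"
    and mean: "\<alpha> \<le> 1 \<longrightarrow> expectation (U 1 1) * expectation (V 1 1) = 0" and \<epsilon>: "0 < \<epsilon>"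
  shows "AE x in M. eventually (\<lambda>n. \<forall>i\<in>{1..K * n}. \<forall>j\<in>{1..K * n}. i \<noteq> j \<longrightarrow>
    \<bar>\<Sum>k=1..n. U k i x * V k j x\<bar> < \<epsilon> * real n powr \<alpha>) sequentially"
proof -
  have \<alpha>0: "0 < \<alpha>" using \<alpha> by simp
  \<comment> \<open>For \<alpha> \<le> 1 the product \<alpha> r is 2 \<alpha>, for \<alpha> > 1 it
    is the smaller of \<alpha> and 2. It exceeds 1 in both cases, in the first because \<alpha> >
    1/2.\<close>
  define r where "r = (if \<alpha> \<le> 1 then 2 else min 1 (2 / \<alpha>))"
  have r: "0 \<le> r" "r \<le> 2 / \<alpha>" "r \<le> 2" "1 < \<alpha> * r"
    using \<alpha> by (auto simp: r_def min_def field_simps)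
  have int: "integrable M (\<lambda>x. \<bar>U k i x * V k j x\<bar> powr s)"
    if "k \<ge> 1" "i \<ge> 1" "j \<ge> 1" "i \<noteq> j" "0 \<le> s" "s \<le> 2 / \<alpha>" for k i j s
    using integrable_powr_XY[OF summ \<alpha>0, of "(k, i)" "(k, j)" s] that by simp
  have centred: "r \<le> 1 \<or> 1 \<le> r \<and> (\<forall>k i j. k \<ge> 1 \<longrightarrow> i \<ge> 1 \<longrightarrow> j \<ge> 1 \<longrightarrow> i \<noteq> j \<longrightarrow>
      integrable M (\<lambda>x. U k i x * V k j x) \<and> expectation (\<lambda>x. U k i x * V k j x) = 0)"
  proof (cases "\<alpha> \<le> 1")
    case True
    have "integrable M (\<lambda>x. U k i x * V k j x) \<and> expectation (\<lambda>x. U k i x * V k j x) = 0"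
      if kij: "k \<ge> 1" "i \<ge> 1" "j \<ge> 1" "i \<noteq> j" for k i j
    proof
      note [measurable] = rv_U[OF kij(1,2)] rv_V[OF kij(1,3)]
      have "integrable M (\<lambda>x. \<bar>U k i x * V k j x\<bar>)"
        using int[OF kij, of 1] True \<alpha> by (simp add: field_simps)
      then show "integrable M (\<lambda>x. U k i x * V k j x)"
        by (subst (asm) integrable_abs_iff) simp_all
      have "expectation (\<lambda>x. U k i x * V k j x) = expectation (U k i) * expectation (V k j)"
        using expectation_XY[OF summ \<alpha>0 True, of "(k, i)" "(k, j)"] kij by simp
      also have "\<dots> = expectation (U 1 1) * expectation (V 1 1)"
        using expectation_X_eq[of "(k, i)" "(1, 1)"] kij
          iid_pairs.expectation_X_eq[OF iid_pairs_swap, of "(k, j)" "(1, 1)"] by simp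
      finally show "expectation (\<lambda>x. U k i x * V k j x) = 0"
        using mean True by simp
    qed
    then show ?thesis using True by (simp add: r_def)
  qed (simp add: r_def)
  obtain \<eta> where \<eta>: "0 < \<eta>" and trunc:
    "AE x in M. eventually (\<lambda>n. \<forall>i\<in>{1..K * n}. \<forall>j\<in>{1..K * n}. i \<noteq> j \<longrightarrow>
      \<bar>\<Sum>k=1..n. if \<bar>U k i x * V k j x\<bar> \<le> \<eta> * real n powr \<alpha> then U k i x * V k j x else 0\<bar>
        < \<epsilon> * real n powr \<alpha>) sequentially"
    using eventually_truncated_sums_small[OF r(3,4) \<epsilon> int[OF _ _ _ _ r(1,2)] centred, of K] by blast
  from trunc eventually_entries_small[OF summ \<alpha>0 \<eta>, of K] show ?thesis
  proof eventually_elim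
    case (elim x)
    from elim show ?case
    proof eventually_elim
      case (elim n)
      show ?case
      proof (intro ballI impI)
        fix i j assume ij: "i \<in> {1..K * n}" "j \<in> {1..K * n}" "i \<noteq> j"
        have eq: "(\<Sum>k=1..n. if \<bar>U k i x * V k j x\<bar> \<le> \<eta> * real n powr \<alpha> then U k i x * V k j x else 0)
            = (\<Sum>k=1..n. U k i x * V k j x)"
          using elim(2) ij by (intro sum.cong) (auto intro: less_imp_le)
        show "\<bar>\<Sum>k=1..n. U k i x * V k j x\<bar> < \<epsilon> * real n powr \<alpha>"
          using elim(1)[rule_format, OF ij] unfolding eq .
      qed
    qed
  qed
qed

section \<open>Necessity of the conditions\<close>

text \<open>The events \<open>B n\<close> concern different rows, so they are independent and the
  second Borel-Cantelli lemma gives summability with \<open>Suc n div K\<close> columns.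
  \<open>exceed_prob_scale\<close> returns to \<open>Suc n\<close> columns.\<close>

lemma summable_of_eventually_row_small:
  assumes small: "AE x in M. eventually (\<lambda>n. \<forall>i\<in>{1..n div K}. \<forall>j\<in>{1..n div K}. i \<noteq> j \<longrightarrow>
    \<bar>U n i x * V n j x\<bar> < real n powr \<alpha>) sequentially" and K: "0 < K"
  shows "summable (\<lambda>n. exceed_prob (Suc n) (real (Suc n) powr \<alpha>))"
proof -
  define R where "R n = {Suc n} \<times> {1..Suc n div K}" for n
  define t where "t n = real (Suc n) powr \<alpha>" for n
  define B where "B n = space M - exceed (R n) (t n)" for n
  let ?W = "\<lambda>a x. ((case a of (k, i) \<Rightarrow> U k i) x, (case a of (k, i) \<Rightarrow> V k i) x)"
  let ?P = "\<lambda>n (w :: nat \<times> nat \<Rightarrow> real \<times> real).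
    \<not> (\<exists>a\<in>R n. \<exists>b\<in>R n. a \<noteq> b \<and> t n \<le> \<bar>fst (w a) * snd (w b)\<bar>)"
  have rows: "indep_vars (\<lambda>n. PiM (R n) (\<lambda>_. borel)) (\<lambda>n x. \<lambda>a\<in>R n. ?W a x) UNIV"
    by (rule indep_vars_restrict[OF indep]) (auto simp: R_def disjoint_family_on_def)
  have "indep_events (\<lambda>n. {x \<in> space M. ?P n (\<lambda>a\<in>R n. ?W a x)}) UNIV"
  proof (rule indep_eventsI_indep_vars[OF rows])
    fix n
    have [simp]: "finite (R n)" by (simp add: R_def)
    have "{w \<in> space (PiM (R n) (\<lambda>_. borel \<Otimes>\<^sub>M borel)). ?P n w} \<in> sets (PiM (R n) (\<lambda>_. borel \<Otimes>\<^sub>M borel))"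
      by measurable
    then show "{w \<in> space (PiM (R n) (\<lambda>_. borel)). ?P n w} \<in> sets (PiM (R n) (\<lambda>_. borel))"
      by (simp only: borel_prod)
  qed
  moreover have "(\<lambda>n. {x \<in> space M. ?P n (\<lambda>a\<in>R n. ?W a x)}) = B"
    unfolding B_def exceed_def by (intro ext set_eqI) auto
  ultimately have ind: "indep_events B UNIV" by simp
  have "AE x in M. eventually (\<lambda>n. x \<in> B n) sequentially"
    using small AE_space
  proof eventually_elim
    case (elim x)
    have "eventually (\<lambda>n. \<forall>i\<in>{1..Suc n div K}. \<forall>j\<in>{1..Suc n div K}. i \<noteq> j \<longrightarrow>
        \<bar>U (Suc n) i x * V (Suc n) j x\<bar> < t n) sequentially"
      using elim(1) unfolding t_def by (subst (asm) eventually_sequentially_Suc[symmetric])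
    then show ?case
    proof eventually_elim
      case (elim n)
      then show ?case
        using \<open>x \<in> space M\<close> unfolding B_def R_def exceed_row by (auto simp: not_le[symmetric])
    qed
  qed
  from indep_events_eventually_imp_summable[OF ind this]
  have "summable (\<lambda>n. 1 - prob (B n))" .
  moreover have "1 - prob (B n) = exceed_prob (Suc n div K) (t n)" for n
    using prob_compl[OF events_exceed_row[of "Suc n"]] prob_exceed_row[of "Suc n"]
    unfolding B_def R_def by simp
  ultimately have summ: "summable (\<lambda>n. (3 * real (2 * K))\<^sup>2 * exceed_prob (Suc n div K) (t n))"
    by (intro summable_mult) simp
  show ?thesis
  proof (rule summable_comparison_test_ev[OF _ summ])
    show "eventually (\<lambda>n. norm (exceed_prob (Suc n) (real (Suc n) powr \<alpha>))
        \<le> (3 * real (2 * K))\<^sup>2 * exceed_prob (Suc n div K) (t n)) sequentially"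
      using eventually_ge_at_top[of "2 * K"]
    proof eventually_elim
      case (elim n)
      \<comment> \<open>A quotient of at least 2 is required by \<open>exceed_prob_scale\<close>; it
        also absorbs the remainder, giving Suc n \<le> 2 K (Suc n div K).\<close>
      have 2: "2 \<le> Suc n div K"
        using elim K by (simp add: less_eq_div_iff_mult_less_eq)
      have "Suc n < K * (Suc n div K) + K"
        using K by (metis add.commute dividend_less_div_times mult.commute)
      also have "\<dots> \<le> K * (Suc n div K) + K * (Suc n div K)"
        using 2 by (intro add_left_mono) (metis mult.right_neutral mult_le_mono2 le_trans one_le_numeral)
      finally have "Suc n \<le> 2 * K * (Suc n div K)" by simp
      from exceed_prob_scale[OF 2 this, of "t n"] show ?case
        by (simp add: t_def exceed_prob_nonneg)
    qed
  qed
qed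

text \<open>One pair of columns suffices. Since \<alpha> \<le> 1, the products have a second moment
  because 2 \<le> 2 / \<alpha>, and division by n is at least as strong as division by
  n^\<alpha>.\<close>

lemma mean_zero_of_sums_small:
  assumes summ: "summable (\<lambda>n. exceed_prob (Suc n) (real (Suc n) powr \<alpha>))" and \<alpha>: "0 < \<alpha>" "\<alpha> \<le> 1"
    and lim: "AE x in M. (\<lambda>n. (\<Sum>k=1..n. U k 1 x * V k 2 x) / real n powr \<alpha>) \<longlonglongrightarrow> 0"
  shows "expectation (U 1 1) * expectation (V 1 1) = 0"
proof (rule mean_zero_of_averages_tendsto_zero)
  show "indep_vars (\<lambda>_. borel) (\<lambda>k x. U k 1 x * V k 2 x) {1..}"
    by (rule indep_products) auto
  fix k :: nat assume k: "k \<ge> 1"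
  have [measurable]: "random_variable borel (U k 1)" "random_variable borel (V k 2)"
    using k by auto
  have int: "integrable M (\<lambda>x. \<bar>U k 1 x * V k 2 x\<bar> powr s)" if "0 \<le> s" "s \<le> 2 / \<alpha>" for s
    using integrable_powr_XY[OF summ \<alpha>(1), of "(k, 1)" "(k, 2)" s] that k by simp
  have "integrable M (\<lambda>x. \<bar>U k 1 x * V k 2 x\<bar>)"
    using int[of 1] \<alpha> by (simp add: field_simps)
  moreover have "random_variable borel (\<lambda>x. U k 1 x * V k 2 x)"
    by measurable
  ultimately show "integrable M (\<lambda>x. U k 1 x * V k 2 x)"
    by (simp add: integrable_abs_iff)
  show "integrable M (\<lambda>x. (U k 1 x * V k 2 x)\<^sup>2)"
    using int[of 2] \<alpha> by (simp add: field_simps)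
  show "expectation (\<lambda>x. (U k 1 x * V k 2 x)\<^sup>2) = expectation (\<lambda>x. (U 1 1 x * V 1 2 x)\<^sup>2)"
    using expectation_fun_XY_eq[of "\<lambda>z. z\<^sup>2" "(k, 1)" "(k, 2)" "(1, 1)" "(1, 2)"] k by simp
  have "expectation (\<lambda>x. U k 1 x * V k 2 x) = expectation (U k 1) * expectation (V k 2)"
    using expectation_XY[OF summ \<alpha>, of "(k, 1)" "(k, 2)"] k by simp
  also have "\<dots> = expectation (U 1 1) * expectation (V 1 1)"
    using expectation_X_eq[of "(k, 1)" "(1, 1)"] k
      iid_pairs.expectation_X_eq[OF iid_pairs_swap, of "(k, 2)" "(1, 1)"] by simp
  finally show "expectation (\<lambda>x. U k 1 x * V k 2 x) = expectation (U 1 1) * expectation (V 1 1)" .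
next
  show "AE x in M. (\<lambda>n. (\<Sum>k=1..n. U k 1 x * V k 2 x) / real n) \<longlonglongrightarrow> 0"
    using lim
  proof eventually_elim
    case (elim x)
    show ?case
    proof (rule Lim_null_comparison[OF _ tendsto_rabs_zero[OF elim]])
      show "eventually (\<lambda>n. norm ((\<Sum>k=1..n. U k 1 x * V k 2 x) / real n)
          \<le> \<bar>(\<Sum>k=1..n. U k 1 x * V k 2 x) / real n powr \<alpha>\<bar>) sequentially"
        using eventually_ge_at_top[of 1]
      proof eventually_elim
        case (elim n)
        then have "real n powr \<alpha> \<le> real n powr 1"
          using \<alpha> by (intro powr_mono) auto
        then show ?case
          using elim by (auto simp: abs_divide intro!: divide_left_mono)
      qed
    qed
  qed
qed

end

section \<open>Passage between \<open>p n\<close> and multiples of \<open>n\<close>\<close>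

theorem theorem3p2:
  fixes M :: "'s measure"
    and U V :: "nat \<Rightarrow> nat \<Rightarrow> 's \<Rightarrow> real"
    and p :: "nat \<Rightarrow> nat"
    and \<alpha> :: real
  assumes "prob_space M"
    and rv: "\<And>k i. (\<lambda>x. (U k i x, V k i x)) \<in> borel_measurable M"
    and indep: "prob_space.indep_vars M (\<lambda>_. borel) (\<lambda>(k, i) x. (U k i x, V k i x))
                  ({1..} \<times> {1..})"
    and ident: "\<And>k i. k \<ge> 1 \<Longrightarrow> i \<ge> 1 \<Longrightarrow>
                  distr M borel (\<lambda>x. (U k i x, V k i x)) = distr M borel (\<lambda>x. (U 1 1 x, V 1 1 x))"
    and ppos: "\<And>n. n \<ge> 1 \<Longrightarrow> p n \<ge> 1"
    and pbd: "\<exists>c C. 0 < c \<and> (\<forall>n\<ge>1. c \<le> real n / real (p n) \<and> real n / real (p n) \<le> C)"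
    and \<alpha>: "\<alpha> > 1/2"
  shows "(AE x in M. ((\<lambda>n. offdiag_max (p n) (\<lambda>i j. \<Sum>k=1..n. U k i x * V k j x) / real n powr \<alpha>)
              \<longlongrightarrow> 0) sequentially)
         \<longleftrightarrow> (summable (\<lambda>n. measure M {x \<in> space M.
                  offdiag_max (Suc n) (\<lambda>i j. U 1 i x * V 1 j x) \<ge> real (Suc n) powr \<alpha>})
              \<and> (\<alpha> \<le> 1 \<longrightarrow> prob_space.expectation M (U 1 1) * prob_space.expectation M (V 1 1) = 0))"
proof -
  interpret prob_space M by fact
  interpret iid_array M U V
    using indep ident by unfold_locales
  let ?T = "\<lambda>n x. offdiag_max (p n) (\<lambda>i j. \<Sum>k=1..n. U k i x * V k j x)"
  have \<alpha>0: "0 < \<alpha>" using \<alpha> by simp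
  obtain c C where c: "0 < c" and pc: "\<And>n. n \<ge> 1 \<Longrightarrow> c \<le> real n / real (p n)"
    and pC: "\<And>n. n \<ge> 1 \<Longrightarrow> real n / real (p n) \<le> C"
    using pbd by blast
  have C: "0 < C" using c pc[of 1] pC[of 1] by simp
  have p_upper: "real (p n) \<le> real n / c" and p_lower: "real n / C \<le> real (p n)" if "n \<ge> 1" for n
    using pc[OF that] pC[OF that] ppos[OF that] c C by (auto simp: field_simps)
  \<comment> \<open>The level is positive, so the convention for an empty maximum does not affect
    the event.\<close>
  have "{x \<in> space M. real (Suc n) powr \<alpha> \<le> offdiag_max (Suc n) (\<lambda>i j. U 1 i x * V 1 j x)}
      = exceed ({1} \<times> {1..Suc n}) (real (Suc n) powr \<alpha>)" for n
  proof -
    have "0 < real (Suc n) powr \<alpha>" by simp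
    then show ?thesis
      unfolding exceed_row not_less[symmetric] offdiag_max_less_iff[OF \<open>0 < real (Suc n) powr \<alpha>\<close>]
      by blast
  qed
  then have rows: "(\<lambda>n. prob {x \<in> space M. real (Suc n) powr \<alpha> \<le> offdiag_max (Suc n) (\<lambda>i j. U 1 i x * V 1 j x)})
      = (\<lambda>n. exceed_prob (Suc n) (real (Suc n) powr \<alpha>))"
    by (simp only: prob_exceed_row[OF order_refl])
  show ?thesis
    unfolding rows
  proof (intro iffI conjI impI)
    assume lim: "AE x in M. (\<lambda>n. ?T n x / real n powr \<alpha>) \<longlonglongrightarrow> 0"
    \<comment> \<open>With K \<ge> 2 C, \<open>n div K\<close> is at most n / (2 C), hence at most
      both \<open>p n\<close> and \<open>p (n - 1)\<close>; \<open>p\<close> need not be monotone,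
      so both are needed.\<close>
    obtain K :: nat where "2 * C + 1 < real K"
      using reals_Archimedean2 by blast
    then have K: "0 < K" "2 * C \<le> real K" using C by (auto intro: gr0I)
    have "AE x in M. eventually (\<lambda>n. \<forall>i\<in>{1..n div K}. \<forall>j\<in>{1..n div K}. i \<noteq> j \<longrightarrow>
      \<bar>U n i x * V n j x\<bar> < real n powr \<alpha>) sequentially"
      using lim
    proof eventually_elim
      case (elim x)
      have "eventually (\<lambda>n. ?T n x / real n powr \<alpha> < 1 / 2) sequentially"
        using elim by (rule order_tendstoD) simp
      with eventually_ge_at_top[of 1]
      have T: "eventually (\<lambda>n. ?T n x < real n powr \<alpha> / 2) sequentially"
        by eventually_elim (simp add: field_simps)
      then have "eventually (\<lambda>n. ?T (n - 1) x < real (n - 1) powr \<alpha> / 2) sequentially"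
        by (rule eventually_compose_filterlim) (rule filterlim_minus_const_nat_at_top)
      with T eventually_ge_at_top[of 2] show ?case
      proof eventually_elim
        case (elim n)
        have "real (n div K) \<le> real n / real K"
          by (rule of_nat_div_le_of_nat)
        also have "\<dots> \<le> real n / (2 * C)"
          using K C by (intro divide_left_mono) auto
        finally have h: "real (n div K) \<le> real n / (2 * C)" .
        \<comment> \<open>This is n \<le> 2 (n - 1), true from n = 2 on.\<close>
        have "real n / (2 * C) \<le> real (n - 1) / C"
          using elim C by (simp add: field_simps of_nat_diff)
        also have "\<dots> \<le> real (p (n - 1))"
          using elim by (intro p_lower) auto
        finally have h1: "n div K \<le> p (n - 1)" using h by linarith
        have "real n / (2 * C) \<le> real n / C"
          using C by (intro divide_left_mono) auto
        also have "\<dots> \<le> real (p n)"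
          using elim by (intro p_lower) auto
        finally have h2: "n div K \<le> p n" using h by linarith
        show ?case
        proof (intro ballI impI)
          fix i j assume ij: "i \<in> {1..n div K}" "j \<in> {1..n div K}" "i \<noteq> j"
          let ?S = "\<lambda>n. \<Sum>k=1..n. U k i x * V k j x"
          \<comment> \<open>Both partial sums are below n^\<alpha> / 2 in absolute value, so their
            difference, the product in row n, is below n^\<alpha>.\<close>
          have "?S n = ?S (n - 1) + U n i x * V n j x"
            using elim by (cases n) auto
          moreover have "\<bar>?S n\<bar> \<le> ?T n x"
            using ij h2 by (intro offdiag_max_ge) auto
          moreover have "\<bar>?S (n - 1)\<bar> \<le> ?T (n - 1) x"
            using ij h1 by (intro offdiag_max_ge) auto
          moreover have "real (n - 1) powr \<alpha> \<le> real n powr \<alpha>"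
            using \<alpha>0 by (intro powr_mono2) auto
          ultimately show "\<bar>U n i x * V n j x\<bar> < real n powr \<alpha>"
            using elim by linarith
        qed
      qed
    qed
    then show summ: "summable (\<lambda>n. exceed_prob (Suc n) (real (Suc n) powr \<alpha>))"
      using K(1) by (rule summable_of_eventually_row_small)
    assume "\<alpha> \<le> 1"
    have "AE x in M. (\<lambda>n. (\<Sum>k=1..n. U k 1 x * V k 2 x) / real n powr \<alpha>) \<longlonglongrightarrow> 0"
      using lim
    proof eventually_elim
      case (elim x)
      \<comment> \<open>From \<open>N\<close> on, p n \<ge> 2, so columns 1 and 2 take part in the
        maximum.\<close>
      obtain N :: nat where N: "2 * C < real N"
        using reals_Archimedean2 by blast
      show ?case
      proof (rule Lim_null_comparison[OF _ elim])
        show "eventually (\<lambda>n. norm ((\<Sum>k=1..n. U k 1 x * V k 2 x) / real n powr \<alpha>)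
            \<le> ?T n x / real n powr \<alpha>) sequentially"
          using eventually_ge_at_top[of "max 1 N"]
        proof eventually_elim
          case (elim n)
          have "2 \<le> real n / C"
            using elim N C by (simp add: field_simps)
          also have "\<dots> \<le> real (p n)"
            using elim by (intro p_lower) auto
          finally have "\<bar>\<Sum>k=1..n. U k 1 x * V k 2 x\<bar> \<le> ?T n x"
            by (intro offdiag_max_ge) auto
          then show ?case
            by (simp add: abs_divide divide_right_mono)
        qed
      qed
    qed
    from mean_zero_of_sums_small[OF summ \<alpha>0 \<open>\<alpha> \<le> 1\<close> this]
    show "expectation (U 1 1) * expectation (V 1 1) = 0" .
  next
    assume *: "summable (\<lambda>n. exceed_prob (Suc n) (real (Suc n) powr \<alpha>)) \<and>
      (\<alpha> \<le> 1 \<longrightarrow> expectation (U 1 1) * expectation (V 1 1) = 0)"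
    obtain K :: nat where K: "1 / c < real K"
      using reals_Archimedean2 by blast
    \<comment> \<open>Countably many tolerances 1 / (N + 1) give one common null set; K > 1 / c
      ensures p n \<le> K n.\<close>
    have "AE x in M. \<forall>N. eventually (\<lambda>n. \<forall>i\<in>{1..K * n}. \<forall>j\<in>{1..K * n}. i \<noteq> j \<longrightarrow>
        \<bar>\<Sum>k=1..n. U k i x * V k j x\<bar> < 1 / real (Suc N) * real n powr \<alpha>) sequentially"
      unfolding AE_all_countable using * \<alpha> by (intro allI eventually_sums_small) auto
    then show "AE x in M. (\<lambda>n. ?T n x / real n powr \<alpha>) \<longlonglongrightarrow> 0"
    proof eventually_elim
      case (elim x)
      show ?case
      proof (rule tendstoI)
        fix e :: real assume "0 < e"
        then obtain N where N: "1 / real (Suc N) < e"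
          using reals_Archimedean by (auto simp: inverse_eq_divide)
        show "eventually (\<lambda>n. dist (?T n x / real n powr \<alpha>) 0 < e) sequentially"
          using elim[rule_format, of N] eventually_ge_at_top[of 1]
        proof eventually_elim
          case (elim n)
          have "real (p n) \<le> real n * (1 / c)"
            using p_upper[of n] elim by simp
          also have "\<dots> \<le> real n * real K"
            using K by (intro mult_left_mono) auto
          also have "\<dots> = real (K * n)" by simp
          finally have "p n \<le> K * n" by (simp only: of_nat_le_iff)
          then have pK: "i \<in> {1..p n} \<Longrightarrow> i \<in> {1..K * n}" for i by simp
          have pos: "0 < real n powr \<alpha>" using elim by simp
          have "?T n x < 1 / real (Suc N) * real n powr \<alpha>"
            using elim(1) pK pos by (subst offdiag_max_less_iff) (simp, blast)
          also have "\<dots> \<le> e * real n powr \<alpha>"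
            using N by (intro mult_right_mono) auto
          finally show ?case
            using pos offdiag_max_nonneg by (simp add: field_simps dist_real_def)
        qed
      qed
    qed
  qed
qed

end
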